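(* Let $\Delta$ be a $1$-dimensional forest (all of whose facets are edges) with vertices $x_1,\dots,x_n$, and let $I\subset R=K[x_1,\dots,x_n]$ be its edge ideal. Then the Castelnuovo–Mumford regularity of $R/I$ is the maximal number $j$ for which there exist $j$ edges of $\Delta$ which are pairwise disconnected.
   Context: $K$ is a field. A $1$-dimensional forest (all of whose facets are edges) is a finite simple graph without cycles and without isolated vertices. The vertices are identified with the variables of $R=K[x_1,\dots,x_n]$, and the edge ideal $I$ is generated by the monomials $x_ix_j$ with $\{x_i,x_j\}$ an edge. Two edges $\{x_i,x_j\}$ and $\{x_k,x_l\}$ of a simple graph $\Delta$ are called disconnected if (a) $\{x_i,x_j\}\cap\{x_k,x_l\}=\emptyset$ and (b) none of $\{x_i,x_k\}$, $\{x_i,x_l\}$, $\{x_j,x_k\}$, $\{x_j,x_l\}$ is an edge of $\Delta$. *)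

theory Defs
  imports
    "HOL-Library.Poly_Mapping"
    "HOL-Algebra.Module"
    "HOL-Algebra.QuotRing"
begin

section \<open>The polynomial ring\<close>

text \<open>A monomial is an exponent vector \<open>'x \<Rightarrow>\<^sub>0 nat\<close>, so \<open>('x, 'k) mpoly\<close> is the
  polynomial ring over \<open>'k\<close> whose variables are the elements of \<open>'x\<close>. The record
  \<open>mpoly_ring\<close> makes the ideals, quotients and modules of HOL-Algebra available for it.\<close>

type_synonym ('x, 'k) mpoly = "('x \<Rightarrow>\<^sub>0 nat) \<Rightarrow>\<^sub>0 'k"

definition Var :: "'x \<Rightarrow> ('x, 'k::field) mpoly" where
  "Var i = Poly_Mapping.single (Poly_Mapping.single i 1) 1"

definition mpoly_ring :: "('x, 'k::field) mpoly ring" where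
  "mpoly_ring = \<lparr>carrier = UNIV, mult = (*), one = 1, zero = 0, add = (+)\<rparr>"

definition monom_degree :: "('x \<Rightarrow>\<^sub>0 nat) \<Rightarrow> nat" where
  "monom_degree m = (\<Sum>i\<in>Poly_Mapping.keys m. Poly_Mapping.lookup m i)"

text \<open>Zero is homogeneous of every degree, and it is the only homogeneous polynomial of
  negative degree.\<close>

definition homogeneous :: "int \<Rightarrow> ('x, 'k::field) mpoly \<Rightarrow> bool" where
  "homogeneous d p \<longleftrightarrow> (\<forall>m\<in>Poly_Mapping.keys p. int (monom_degree m) = d)"

definition irrelevant_ideal :: "('x, 'k::field) mpoly set" where
  "irrelevant_ideal = Idl\<^bsub>mpoly_ring\<^esub> (range Var)"


section \<open>Graded modules\<close>

record ('a, 'b) graded_module = "('a, 'b) module" +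
  graded_part :: "int \<Rightarrow> 'b set"

text \<open>The quotient \<open>R/I\<close> with its standard grading (meaningful for homogeneous \<open>I\<close>).\<close>

definition quotient_module ::
  "('x, 'k::field) mpoly set \<Rightarrow> (('x, 'k) mpoly, ('x, 'k) mpoly set) graded_module" where
  "quotient_module I =
    \<lparr>carrier = carrier (mpoly_ring Quot I), mult = mult (mpoly_ring Quot I),
     one = one (mpoly_ring Quot I), zero = zero (mpoly_ring Quot I),
     add = add (mpoly_ring Quot I),
     smult = (\<lambda>r X. (I +>\<^bsub>mpoly_ring\<^esub> r) \<otimes>\<^bsub>mpoly_ring Quot I\<^esub> X),
     graded_part = (\<lambda>d. {I +>\<^bsub>mpoly_ring\<^esub> p | p. homogeneous d p})\<rparr>"

text \<open>The free module \<open>R(-a\<^sub>0) \<oplus> \<dots> \<oplus> R(-a\<^sub>r\<^sub>-\<^sub>1)\<close> for \<open>as = [a\<^sub>0, \<dots>, a\<^sub>r\<^sub>-\<^sub>1]\<close>: the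
  \<open>k\<close>-th basis vector has degree \<open>as ! k\<close>. The fields \<open>mult\<close> and \<open>one\<close>, which the module
  record inherits from the ring record, carry no meaning for modules.\<close>

definition graded_free ::
  "int list \<Rightarrow> (('x, 'k::field) mpoly, nat \<Rightarrow>\<^sub>0 ('x, 'k) mpoly) graded_module" where
  "graded_free as =
    \<lparr>carrier = {v. Poly_Mapping.keys v \<subseteq> {..<length as}}, mult = undefined, one = undefined,
     zero = 0, add = (+),
     smult = (\<lambda>r. Poly_Mapping.map ((*) r)),
     graded_part = (\<lambda>d. {v. Poly_Mapping.keys v \<subseteq> {..<length as} \<and>
        (\<forall>k<length as. homogeneous (d - as ! k) (Poly_Mapping.lookup v k))})\<rparr>"

definition graded_hom ::
  "(('x, 'k::field) mpoly, 'b, 'm) graded_module_scheme \<Rightarrow>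
   (('x, 'k) mpoly, 'c, 'n) graded_module_scheme \<Rightarrow> ('b \<Rightarrow> 'c) set" where
  "graded_hom M N = {h.
     h \<in> carrier M \<rightarrow> carrier N \<and>
     (\<forall>u\<in>carrier M. \<forall>v\<in>carrier M. h (u \<oplus>\<^bsub>M\<^esub> v) = h u \<oplus>\<^bsub>N\<^esub> h v) \<and>
     (\<forall>r. \<forall>v\<in>carrier M. h (r \<odot>\<^bsub>M\<^esub> v) = r \<odot>\<^bsub>N\<^esub> h v) \<and>
     (\<forall>d. h ` graded_part M d \<subseteq> graded_part N d)}"

definition hom_kernel ::
  "(('x, 'k::field) mpoly, 'b, 'm) graded_module_scheme \<Rightarrow>
   (('x, 'k) mpoly, 'c, 'n) graded_module_scheme \<Rightarrow> ('b \<Rightarrow> 'c) \<Rightarrow> 'b set" where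
  "hom_kernel M N h = {v \<in> carrier M. h v = \<zero>\<^bsub>N\<^esub>}"


section \<open>Castelnuovo--Mumford regularity\<close>

text \<open>A minimal graded free resolution
  \[ \dots \to F_2 \to F_1 \to F_0 \to M \to 0 \]
  with \<open>F i = graded_free (a i)\<close>, differentials \<open>\<delta> i : F (i + 1) \<rightarrow> F i\<close> and augmentation
  \<open>\<epsilon> : F 0 \<rightarrow> M\<close>. Finite resolutions are continued by zero modules (\<open>a i = []\<close>).
  Minimality says that the image of \<open>\<delta> i\<close> lies in the product of the irrelevant ideal
  with \<open>F i\<close>, that is, that all coordinates of its elements lie in the irrelevant ideal.\<close>

definition minimal_graded_free_resolution ::
  "(('x, 'k::field) mpoly, 'b, 'm) graded_module_scheme \<Rightarrow> (nat \<Rightarrow> int list) \<Rightarrow>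
   (nat \<Rightarrow> (nat \<Rightarrow>\<^sub>0 ('x, 'k) mpoly) \<Rightarrow> (nat \<Rightarrow>\<^sub>0 ('x, 'k) mpoly)) \<Rightarrow>
   ((nat \<Rightarrow>\<^sub>0 ('x, 'k) mpoly) \<Rightarrow> 'b) \<Rightarrow> bool" where
  "minimal_graded_free_resolution M a \<delta> \<epsilon> \<longleftrightarrow>
     \<epsilon> \<in> graded_hom (graded_free (a 0)) M \<and>
     (\<forall>i. \<delta> i \<in> graded_hom (graded_free (a (Suc i))) (graded_free (a i))) \<and>
     \<epsilon> ` carrier (graded_free (a 0)) = carrier M \<and>
     \<delta> 0 ` carrier (graded_free (a 1)) = hom_kernel (graded_free (a 0)) M \<epsilon> \<and>
     (\<forall>i. \<delta> (Suc i) ` carrier (graded_free (a (Suc (Suc i)))) =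
        hom_kernel (graded_free (a (Suc i))) (graded_free (a i)) (\<delta> i)) \<and>
     (\<forall>i. \<forall>v\<in>carrier (graded_free (a (Suc i))). \<forall>k.
        Poly_Mapping.lookup (\<delta> i v) k \<in> irrelevant_ideal)"

text \<open>The graded Betti number \<open>\<beta>\<^sub>i\<^sub>,\<^sub>j(M)\<close> is the number of summands \<open>R(-j)\<close> in the \<open>i\<close>-th
  module of a minimal graded free resolution of \<open>M\<close>. Such a resolution of a finitely
  generated graded module exists and is unique up to isomorphism, so the choice of the
  shifts does not matter.\<close>

definition graded_betti ::
  "(('x, 'k::field) mpoly, 'b, 'm) graded_module_scheme \<Rightarrow> nat \<Rightarrow> int \<Rightarrow> nat" where
  "graded_betti M i j =
     count_list ((SOME a. \<exists>\<delta> \<epsilon>. minimal_graded_free_resolution M a \<delta> \<epsilon>) i) j"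

definition cm_regularity ::
  "(('x, 'k::field) mpoly, 'b, 'm) graded_module_scheme \<Rightarrow> int" where
  "cm_regularity M = Max {j. \<exists>i. graded_betti M i (int i + j) \<noteq> 0}"


section \<open>Graphs\<close>

text \<open>A simple graph whose vertex set is the type \<open>'x\<close> is given by its set of edges, which
  are two-element sets.\<close>

definition has_cycle :: "'x set set \<Rightarrow> bool" where
  "has_cycle E \<longleftrightarrow> (\<exists>vs. 3 \<le> length vs \<and> distinct vs \<and>
     (\<forall>i<length vs. {vs ! i, vs ! (Suc i mod length vs)} \<in> E))"

definition one_dim_forest :: "'x::finite set set \<Rightarrow> bool" where
  "one_dim_forest E \<longleftrightarrow> (\<forall>e\<in>E. card e = 2) \<and> \<Union>E = UNIV \<and> \<not> has_cycle E"

definition edge_ideal :: "'x set set \<Rightarrow> ('x, 'k::field) mpoly set" where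
  "edge_ideal E = Idl\<^bsub>mpoly_ring\<^esub> {Var i * Var j | i j. {i, j} \<in> E}"

definition disconnected_edges :: "'x set set \<Rightarrow> 'x set \<Rightarrow> 'x set \<Rightarrow> bool" where
  "disconnected_edges E e f \<longleftrightarrow> e \<inter> f = {} \<and> (\<forall>u\<in>e. \<forall>v\<in>f. {u, v} \<notin> E)"


section \<open>The structures are as intended\<close>

lemma cring_mpoly_ring: "cring (mpoly_ring :: ('x, 'k::field) mpoly ring)"
proof (intro cringI abelian_groupI comm_monoidI)
  show "\<exists>y\<in>carrier mpoly_ring. y \<oplus>\<^bsub>mpoly_ring\<^esub> x = \<zero>\<^bsub>mpoly_ring\<^esub>"
    for x :: "('x, 'k) mpoly"
    by (rule bexI[of _ "- x"]) (simp_all add: mpoly_ring_def)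
qed (simp_all add: mpoly_ring_def algebra_simps)

lemma ideal_edge_ideal: "ideal (edge_ideal E :: ('x, 'k::field) mpoly set) mpoly_ring"
  unfolding edge_ideal_def
  by (rule ring.genideal_ideal[OF cring.axioms(1)[OF cring_mpoly_ring]])
     (simp add: mpoly_ring_def)

lemma lookup_map_times:
  fixes r :: "('x, 'k::field) mpoly"
  shows "Poly_Mapping.lookup (Poly_Mapping.map ((*) r) v) k = r * Poly_Mapping.lookup v k"
  by (simp add: map.rep_eq when_def)

lemma module_graded_free:
  "module mpoly_ring (graded_free as :: (('x, 'k::field) mpoly, _) graded_module)"
proof (intro moduleI cring_mpoly_ring abelian_groupI)
  fix x y :: "nat \<Rightarrow>\<^sub>0 ('x, 'k) mpoly"
  assume "x \<in> carrier (graded_free as)" "y \<in> carrier (graded_free as)"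
  then show "x \<oplus>\<^bsub>graded_free as\<^esub> y \<in> carrier (graded_free as)"
    using Poly_Mapping.keys_add[of x y] by (auto simp: graded_free_def)
next
  fix x :: "nat \<Rightarrow>\<^sub>0 ('x, 'k) mpoly"
  assume "x \<in> carrier (graded_free as)"
  then show "\<exists>y\<in>carrier (graded_free as). y \<oplus>\<^bsub>graded_free as\<^esub> x = \<zero>\<^bsub>graded_free as\<^esub>"
    by (intro bexI[of _ "- x"]) (simp_all add: graded_free_def)
next
  fix r :: "('x, 'k) mpoly" and x :: "nat \<Rightarrow>\<^sub>0 ('x, 'k) mpoly"
  assume "x \<in> carrier (graded_free as)"
  then show "r \<odot>\<^bsub>graded_free as\<^esub> x \<in> carrier (graded_free as)"
    by (auto simp: graded_free_def in_keys_iff map.rep_eq when_def subset_iff)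
qed (simp_all add: graded_free_def mpoly_ring_def add_ac,
     (rule poly_mapping_eqI, simp add: lookup_map_times lookup_add algebra_simps)+)

lemma module_quotient_module:
  fixes I :: "('x, 'k::field) mpoly set"
  assumes "ideal I mpoly_ring"
  shows "module mpoly_ring (quotient_module I)"
proof -
  let ?Q = "mpoly_ring Quot I"
  have Q: "ring ?Q"
    using assms by (rule ideal.quotient_is_ring)
  have h: "(+>\<^bsub>mpoly_ring\<^esub>) I \<in> ring_hom mpoly_ring ?Q"
    using assms by (rule ideal.rcos_ring_hom)
  have sel: "carrier (quotient_module I) = carrier ?Q" "add (quotient_module I) = add ?Q"
    "zero (quotient_module I) = zero ?Q"
    "r \<odot>\<^bsub>quotient_module I\<^esub> X = (I +>\<^bsub>mpoly_ring\<^esub> r) \<otimes>\<^bsub>?Q\<^esub> X" for r X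
    by (simp_all add: quotient_module_def)
  have hc: "I +>\<^bsub>mpoly_ring\<^esub> r \<in> carrier ?Q" for r
    using ring_hom_closed[OF h, of r] by (simp add: mpoly_ring_def)
  have R: "r \<in> carrier mpoly_ring" for r :: "('x, 'k) mpoly"
    by (simp add: mpoly_ring_def)
  show ?thesis
  proof (rule moduleI[OF cring_mpoly_ring])
    show "abelian_group (quotient_module I)"
    proof (rule abelian_groupI; unfold sel)
      fix x assume "x \<in> carrier ?Q"
      then show "\<exists>y\<in>carrier ?Q. y \<oplus>\<^bsub>?Q\<^esub> x = \<zero>\<^bsub>?Q\<^esub>"
        using ring.ring_simprules(3,9)[OF Q] by blast
    qed (fact ring.ring_simprules[OF Q])+
  next
    fix a b x y
    assume x: "x \<in> carrier (quotient_module I)" and y: "y \<in> carrier (quotient_module I)"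
    note c = x[unfolded sel] y[unfolded sel] hc[of a] hc[of b]
    show "a \<odot>\<^bsub>quotient_module I\<^esub> x \<in> carrier (quotient_module I)"
      unfolding sel by (rule ring.ring_simprules(5)[OF Q c(3,1)])
    show "(a \<oplus>\<^bsub>mpoly_ring\<^esub> b) \<odot>\<^bsub>quotient_module I\<^esub> x = a \<odot>\<^bsub>quotient_module I\<^esub> x \<oplus>\<^bsub>quotient_module I\<^esub> b \<odot>\<^bsub>quotient_module I\<^esub> x"
      unfolding sel ring_hom_add[OF h R R] by (rule ring.ring_simprules(13)[OF Q c(3,4,1)])
    show "a \<odot>\<^bsub>quotient_module I\<^esub> (x \<oplus>\<^bsub>quotient_module I\<^esub> y) = a \<odot>\<^bsub>quotient_module I\<^esub> x \<oplus>\<^bsub>quotient_module I\<^esub> a \<odot>\<^bsub>quotient_module I\<^esub> y"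
      unfolding sel by (rule ring.ring_simprules(23)[OF Q c(1,2,3)])
    show "(a \<otimes>\<^bsub>mpoly_ring\<^esub> b) \<odot>\<^bsub>quotient_module I\<^esub> x = a \<odot>\<^bsub>quotient_module I\<^esub> (b \<odot>\<^bsub>quotient_module I\<^esub> x)"
      unfolding sel ring_hom_mult[OF h R R] by (rule ring.ring_simprules(11)[OF Q c(3,4,1)])
    show "\<one>\<^bsub>mpoly_ring\<^esub> \<odot>\<^bsub>quotient_module I\<^esub> x = x"
      unfolding sel ring_hom_one[OF h] by (rule ring.ring_simprules(12)[OF Q c(1)])
  qed
qed

end

theory Submission
  imports Defs
begin

text \<open>A forest with an edge has a leaf \<open>x\<close>, with a single neighbour \<open>y\<close>. Let \<open>F\<close> be the forest
  without the edge \<open>xy\<close>, let \<open>N\<close> be the set of neighbours of \<open>y\<close> in \<open>F\<close>, and let \<open>H\<close> consist of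
  the edges of \<open>F\<close> that avoid \<open>y\<close> and \<open>N\<close>. Since \<open>x\<close> does not occur in \<open>I(F)\<close>, the colon ideal
  \<open>I(F) : xy\<close> equals \<open>I(F) : y = I(H) + (N)\<close>, and multiplication by \<open>xy\<close> gives an exact sequence
  \[ 0 \to R/(I(H) + (N))(-2) \to R/I(F) \to R/I(E) \to 0. \]
  A map of minimal resolutions over multiplication by \<open>xy\<close> can be chosen as \<open>x\<close> times a map
  over multiplication by \<open>y\<close>. All its entries then lie in the irrelevant ideal, so the mapping
  cone is again a minimal resolution (\<open>mapping_cone\<close>), and its shifts are known: the shifts of
  \<open>R/I(F)\<close> together with those of the other module raised by 2, one homological degree later.
  Hence the regularity of \<open>R/I(E)\<close> is the maximum of the regularity of \<open>R/I(F)\<close> and one plus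
  the regularity of \<open>R/(I(H) + (N))\<close>. The variables in \<open>N\<close> do not occur in \<open>I(H)\<close>, and such
  variables do not change the regularity, so the induction is over edge ideals to which a set of
  variables away from all edges is added (\<open>bounded_resolution_forest\<close>).

  The maximal number of pairwise disconnected edges satisfies the same recursion
  (\<open>matching_number_leaf\<close>): such a set of edges either lies in \<open>F\<close>, or it consists of \<open>xy\<close> and a
  set of pairwise disconnected edges of \<open>H\<close>.

  The Betti numbers are defined by an arbitrary minimal resolution, so its shifts have to be
  compared with those of the resolution built here. For the regularity only the sets of shifts
  matter. Comparison maps in both directions compose to a map that is homotopic to the identity,
  and by minimality its matrices are identity matrices modulo the irrelevant ideal; a diagonal
  entry 1 is possible only if each shift of the one resolution is also a shift of the other
  (\<open>shifts_unique\<close>).\<close>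

section \<open>Homogeneous components\<close>

abbreviation lookup :: "('a \<Rightarrow>\<^sub>0 'b::zero) \<Rightarrow> 'a \<Rightarrow> 'b" where
  "lookup \<equiv> Poly_Mapping.lookup"

abbreviation keys :: "('a \<Rightarrow>\<^sub>0 'b::zero) \<Rightarrow> 'a set" where
  "keys \<equiv> Poly_Mapping.keys"

type_synonym ('x, 'k) vec = "nat \<Rightarrow>\<^sub>0 ('x, 'k) mpoly"

lemma lookup_mapp_zero:
  "(\<And>k. f k 0 = 0) \<Longrightarrow> lookup (Poly_Mapping.mapp f p) k = f k (lookup p k)"
  by (simp add: lookup_mapp when_def in_keys_iff)

lemma monom_degree_superset:
  "finite A \<Longrightarrow> keys m \<subseteq> A \<Longrightarrow> monom_degree m = (\<Sum>i\<in>A. lookup m i)"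
  unfolding monom_degree_def by (rule sum.mono_neutral_left) (auto simp: in_keys_iff)

lemma monom_degree_add: "monom_degree (m + m') = monom_degree m + monom_degree m'"
proof -
  let ?A = "keys m \<union> keys m'"
  have "keys (m + m') \<subseteq> ?A" by (rule Poly_Mapping.keys_add)
  then show ?thesis
    by (simp add: monom_degree_superset[of ?A] lookup_add sum.distrib)
qed

lemma monom_degree_single [simp]: "monom_degree (Poly_Mapping.single i a) = a"
  by (simp add: monom_degree_def)

lemma monom_degree_zero [simp]: "monom_degree 0 = 0"
  by (simp add: monom_degree_def)

lemma homogeneous_zero [simp]: "homogeneous d 0"
  by (simp add: homogeneous_def)

lemma homogeneous_add: "homogeneous d p \<Longrightarrow> homogeneous d q \<Longrightarrow> homogeneous d (p + q)"
  unfolding homogeneous_def using Poly_Mapping.keys_add[of p q] by blast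

lemma homogeneous_uminus: "homogeneous d p \<Longrightarrow> homogeneous d (- p)"
  by (simp add: homogeneous_def in_keys_iff)

lemma homogeneous_diff: "homogeneous d p \<Longrightarrow> homogeneous d q \<Longrightarrow> homogeneous d (p - q)"
  using homogeneous_add[OF _ homogeneous_uminus, of d p q] by simp

lemma homogeneous_mult: "homogeneous d p \<Longrightarrow> homogeneous e q \<Longrightarrow> homogeneous (d + e) (p * q)"
  unfolding homogeneous_def using Poly_Mapping.keys_mult[of p q]
  by (fastforce simp: monom_degree_add)

lemma homogeneous_one [simp]: "homogeneous 0 1"
  by (simp add: homogeneous_def)

lemma homogeneous_monomial:
  "homogeneous (int (monom_degree m)) (Poly_Mapping.single m (c::'k::field))"
  by (simp add: homogeneous_def)

definition hom_component :: "int \<Rightarrow> ('x, 'k::field) mpoly \<Rightarrow> ('x, 'k) mpoly" where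
  "hom_component d = Poly_Mapping.mapp (\<lambda>m c. if int (monom_degree m) = d then c else 0)"

lemma lookup_hom_component:
  "lookup (hom_component d p) m = (if int (monom_degree m) = d then lookup p m else 0)"
  unfolding hom_component_def by (rule lookup_mapp_zero) simp

lemma hom_component_zero [simp]: "hom_component d 0 = 0"
  by (rule poly_mapping_eqI) (simp add: lookup_hom_component)

lemma hom_component_add: "hom_component d (p + q) = hom_component d p + hom_component d q"
  by (rule poly_mapping_eqI) (simp add: lookup_hom_component lookup_add)

lemma hom_component_diff: "hom_component d (p - q) = hom_component d p - hom_component d q"
  by (rule poly_mapping_eqI) (simp add: lookup_hom_component lookup_minus)

lemma homogeneous_iff: "homogeneous d p \<longleftrightarrow> hom_component d p = p"
proof
  assume "homogeneous d p"
  then show "hom_component d p = p"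
    by (intro poly_mapping_eqI) (auto simp: lookup_hom_component homogeneous_def in_keys_iff)
next
  assume "hom_component d p = p"
  then have "lookup p m = (if int (monom_degree m) = d then lookup p m else 0)" for m
    using lookup_hom_component[of d p m] by simp
  then show "homogeneous d p"
    unfolding homogeneous_def by (metis in_keys_iff)
qed

lemma homogeneous_hom_component: "homogeneous d (hom_component d p)"
  unfolding homogeneous_def by (metis in_keys_iff lookup_hom_component)

text \<open>The factor \<open>r\<close> splits into its component of the right degree, which contributes a
  homogeneous product, and a rest none of whose products with \<open>q\<close> reaches that degree.\<close>

lemma hom_component_mult:
  assumes q: "homogeneous e q"
  shows "hom_component d (r * q) = hom_component (d - e) r * q"
proof -
  let ?h = "hom_component (d - e) r"
  have 1: "homogeneous d (?h * q)"
    using homogeneous_mult[OF homogeneous_hom_component q, of "d - e" r] by simp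
  have 2: "hom_component d ((r - ?h) * q) = 0"
  proof (rule poly_mapping_eqI)
    fix m
    have "int (monom_degree m) \<noteq> d" if m: "m \<in> keys ((r - ?h) * q)"
    proof -
      obtain a b where ab: "m = a + b" "a \<in> keys (r - ?h)" "b \<in> keys q"
        using Poly_Mapping.keys_mult[of "r - ?h" q] m by blast
      have "int (monom_degree a) \<noteq> d - e"
        using ab(2) by (auto simp: in_keys_iff lookup_minus lookup_hom_component split: if_splits)
      moreover have "int (monom_degree b) = e" using q ab(3) by (auto simp: homogeneous_def)
      ultimately show ?thesis using ab(1) by (simp add: monom_degree_add)
    qed
    then show "lookup (hom_component d ((r - ?h) * q)) m = lookup 0 m"
      by (auto simp: lookup_hom_component in_keys_iff)
  qed
  have "hom_component d (r * q) = hom_component d (?h * q + (r - ?h) * q)"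
    by (simp add: algebra_simps)
  also have "\<dots> = ?h * q" using 1 2 by (simp add: hom_component_add homogeneous_iff)
  finally show ?thesis .
qed

text \<open>A sum of exponent vectors vanishes only if both summands do, so taking the constant
  coefficient is multiplicative.\<close>

lemma lookup_zero_mult:
  fixes p q :: "('x, 'k::field) mpoly"
  shows "lookup (p * q) 0 = lookup p 0 * lookup q 0"
proof -
  define p' where "p' = p - Poly_Mapping.single 0 (lookup p 0)"
  have p': "lookup p' 0 = 0" by (simp add: p'_def lookup_minus)
  have "0 \<notin> keys (p' * q)"
  proof
    assume "0 \<in> keys (p' * q)"
    then obtain a b where ab: "0 = a + b" "a \<in> keys p'"
      using Poly_Mapping.keys_mult[of p' q] by blast
    have "a = 0"
    proof (rule poly_mapping_eqI)
      fix i
      have "lookup (a + b) i = 0" using ab(1) by (metis lookup_zero)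
      then show "lookup a i = lookup 0 i" by (simp add: lookup_add)
    qed
    then show False using ab(2) p' by (simp add: in_keys_iff)
  qed
  then have 1: "lookup (p' * q) 0 = 0" by (simp add: in_keys_iff)
  have 2: "Poly_Mapping.single 0 c * q = Poly_Mapping.map ((*) c) q" for c
    by (rule mult_map_scale_conv_mult[symmetric])
  have "p * q = p' * q + Poly_Mapping.single 0 (lookup p 0) * q"
    by (simp add: p'_def algebra_simps)
  then show ?thesis using 1 by (simp add: lookup_add 2 map.rep_eq when_def)
qed

section \<open>Linear maps between free modules\<close>

definition scale :: "('x, 'k::field) mpoly \<Rightarrow> ('x, 'k) vec \<Rightarrow> ('x, 'k) vec" where
  "scale r = Poly_Mapping.map ((*) r)"

definition unit :: "nat \<Rightarrow> ('x, 'k::field) vec" where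
  "unit k = Poly_Mapping.single k 1"

definition free :: "nat \<Rightarrow> ('x, 'k::field) vec set" where
  "free n = {v. keys v \<subseteq> {..<n}}"

lemma lookup_scale [simp]: "lookup (scale r v) k = r * lookup v k"
  unfolding scale_def by (rule lookup_map_times)

lemma lookup_unit: "lookup (unit k) j = (if j = k then 1 else 0)"
  by (auto simp: unit_def lookup_single when_def)

lemma free_iff: "v \<in> free n \<longleftrightarrow> (\<forall>k\<ge>n. lookup v k = 0)"
  unfolding free_def by (auto simp: in_keys_iff subset_iff not_less) (metis not_less)

lemma scale_simps:
  "scale 0 v = 0" "scale 1 v = v" "scale r 0 = 0"
  "scale r (u + v) = scale r u + scale r v" "scale r (u - v) = scale r u - scale r v"
  "scale r (- v) = - scale r v"
  "scale (r + s) v = scale r v + scale s v"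
  "scale r (scale s v) = scale (r * s) v"
  by (rule poly_mapping_eqI; simp add: lookup_add lookup_minus algebra_simps)+

lemma free_closed:
  "0 \<in> free n" "u \<in> free n \<Longrightarrow> v \<in> free n \<Longrightarrow> u + v \<in> free n"
  "u \<in> free n \<Longrightarrow> v \<in> free n \<Longrightarrow> u - v \<in> free n"
  "u \<in> free n \<Longrightarrow> - u \<in> free n" "v \<in> free n \<Longrightarrow> scale r v \<in> free n"
  "k < n \<Longrightarrow> unit k \<in> free n"
  by (auto simp: free_iff lookup_add lookup_minus lookup_unit)

lemma vec_expansion: "v = (\<Sum>k\<in>keys v. scale (lookup v k) (unit k))"
proof (rule poly_mapping_eqI)
  fix j
  have "lookup (\<Sum>k\<in>keys v. scale (lookup v k) (unit k)) j
      = (\<Sum>k\<in>keys v. if k = j then lookup v k else 0)"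
    unfolding lookup_sum lookup_scale lookup_unit by (rule sum.cong) auto
  also have "\<dots> = lookup v j" by (auto simp: in_keys_iff)
  finally show "lookup v j = lookup (\<Sum>k\<in>keys v. scale (lookup v k) (unit k)) j" by simp
qed

lemma free_induct [consumes 1, case_names zero add basis]:
  assumes v: "v \<in> free n"
    and "P 0" "\<And>u v. u \<in> free n \<Longrightarrow> v \<in> free n \<Longrightarrow> P u \<Longrightarrow> P v \<Longrightarrow> P (u + v)"
    and "\<And>r k. k < n \<Longrightarrow> P (scale r (unit k))"
  shows "P v"
proof -
  have "P (\<Sum>k\<in>A. scale (lookup v k) (unit k)) \<and> (\<Sum>k\<in>A. scale (lookup v k) (unit k)) \<in> free n"
    if "finite A" "A \<subseteq> {..<n}" for A
    using that by (induction A) (auto intro!: assms free_closed)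
  from this[of "keys v"] show ?thesis
    using v vec_expansion[of v] by (simp add: free_def)
qed

text \<open>Maps of free modules are extended linearly to all vectors, of any support. Sums, composites and
  lifts of maps can then be formed without conditions on carriers; only statements about values
  refer to \<open>free n\<close>.\<close>

definition module_map :: "(('x, 'k::field) vec \<Rightarrow> ('x, 'k) vec) \<Rightarrow> bool" where
  "module_map f \<longleftrightarrow> (\<forall>u v. f (u + v) = f u + f v) \<and> (\<forall>r v. f (scale r v) = scale r (f v))"

lemma module_mapD:
  assumes "module_map f"
  shows "f (u + v) = f u + f v" "f (scale r v) = scale r (f v)"
    "f 0 = 0" "f (- v) = - f v" "f (u - v) = f u - f v"
proof -
  show a: "f (u + v) = f u + f v" for u v using assms by (simp add: module_map_def)
  show s: "f (scale r v) = scale r (f v)" for r v using assms by (simp add: module_map_def)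
  show z: "f 0 = 0" using a[of 0 0] by simp
  have m: "f (- v) = - f v" for v using a[of v "-v"] z by (simp add: eq_neg_iff_add_eq_0 add.commute)
  show "f (- v) = - f v" by (rule m)
  show "f (u - v) = f u - f v" using a[of u "-v"] m by simp
qed

lemma module_map_compose: "module_map f \<Longrightarrow> module_map g \<Longrightarrow> module_map (\<lambda>v. f (g v))"
  by (simp add: module_map_def)

lemma module_map_id: "module_map (\<lambda>v. v)"
  by (simp add: module_map_def)

lemma module_map_zero: "module_map (\<lambda>v. 0)"
  by (simp add: module_map_def scale_simps)

lemma module_map_scale: "module_map (scale r)"
  by (simp add: module_map_def scale_simps mult.commute)

lemma module_map_add:
  "module_map f \<Longrightarrow> module_map g \<Longrightarrow> module_map (\<lambda>v. f v + g v)"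
  by (simp add: module_map_def scale_simps)

lemma module_map_diff:
  "module_map f \<Longrightarrow> module_map g \<Longrightarrow> module_map (\<lambda>v. f v - g v)"
  by (simp add: module_map_def scale_simps)

lemma module_map_uminus: "module_map f \<Longrightarrow> module_map (\<lambda>v. - f v)"
  by (simp add: module_map_def scale_simps)

lemmas module_map_intros = module_map_id module_map_zero module_map_scale
  module_map_add module_map_diff module_map_uminus

definition extend :: "(nat \<Rightarrow> ('x, 'k::field) vec) \<Rightarrow> ('x, 'k) vec \<Rightarrow> ('x, 'k) vec" where
  "extend c v = (\<Sum>k\<in>keys v. scale (lookup v k) (c k))"

lemma extend_superset:
  "finite A \<Longrightarrow> keys v \<subseteq> A \<Longrightarrow> extend c v = (\<Sum>k\<in>A. scale (lookup v k) (c k))"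
  unfolding extend_def by (rule sum.mono_neutral_left) (auto simp: in_keys_iff scale_simps)

lemma module_map_extend: "module_map (extend c)"
  unfolding module_map_def
proof (intro conjI allI)
  fix u v :: "('a, 'b) vec" and r
  let ?A = "keys u \<union> keys v"
  have "keys (u + v) \<subseteq> ?A" by (rule Poly_Mapping.keys_add)
  then show "extend c (u + v) = extend c u + extend c v"
    by (simp add: extend_superset[of ?A] lookup_add scale_simps sum.distrib)
  have "keys (scale r v) \<subseteq> keys v" by (auto simp: in_keys_iff)
  moreover have "scale r (\<Sum>k\<in>A. f k) = (\<Sum>k\<in>A. scale r (f k))" for f and A :: "nat set"
    by (induction A rule: infinite_finite_induct) (simp_all add: scale_simps)
  ultimately show "extend c (scale r v) = scale r (extend c v)"
    by (simp add: extend_superset[of "keys v"] scale_simps)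
qed

lemma extend_unit [simp]: "extend c (unit k) = c k"
  by (simp add: extend_def unit_def scale_simps)

lemma module_map_eqI:
  assumes "module_map f" "module_map g" "\<And>k. k < n \<Longrightarrow> f (unit k) = g (unit k)" "v \<in> free n"
  shows "f v = g v"
  using assms(4)
  by (induction rule: free_induct)
     (simp_all add: module_mapD[OF assms(1)] module_mapD[OF assms(2)] assms(3))

section \<open>Gradings of free modules\<close>

definition hom_vec :: "int list \<Rightarrow> int \<Rightarrow> ('x, 'k::field) vec \<Rightarrow> bool" where
  "hom_vec as d v \<longleftrightarrow> v \<in> free (length as) \<and>
     (\<forall>k<length as. homogeneous (d - as ! k) (lookup v k))"

definition vec_component :: "int list \<Rightarrow> int \<Rightarrow> ('x, 'k::field) vec \<Rightarrow> ('x, 'k) vec" where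
  "vec_component as d = Poly_Mapping.mapp (\<lambda>k. hom_component (d - as ! k))"

lemma lookup_vec_component:
  "lookup (vec_component as d v) k = hom_component (d - as ! k) (lookup v k)"
  unfolding vec_component_def by (rule lookup_mapp_zero) simp

lemma vec_component_zero [simp]: "vec_component as d 0 = 0"
  by (rule poly_mapping_eqI) (simp add: lookup_vec_component)

lemma vec_component_add:
  "vec_component as d (u + v) = vec_component as d u + vec_component as d v"
  by (rule poly_mapping_eqI) (simp add: lookup_vec_component lookup_add hom_component_add)

lemma vec_component_diff:
  "vec_component as d (u - v) = vec_component as d u - vec_component as d v"
  by (rule poly_mapping_eqI) (simp add: lookup_vec_component lookup_minus hom_component_diff)

lemma vec_component_free: "v \<in> free n \<Longrightarrow> vec_component as d v \<in> free n"
  by (simp add: free_iff lookup_vec_component)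

lemma hom_vec_component:
  "v \<in> free (length as) \<Longrightarrow> hom_vec as d (vec_component as d v)"
  by (simp add: hom_vec_def vec_component_free lookup_vec_component homogeneous_hom_component)

lemma vec_component_hom: "hom_vec as d v \<Longrightarrow> vec_component as d v = v"
proof (rule poly_mapping_eqI)
  fix k assume "hom_vec as d v"
  then show "lookup (vec_component as d v) k = lookup v k"
    by (cases "k < length as")
       (simp_all add: lookup_vec_component hom_vec_def homogeneous_iff free_iff)
qed

lemma hom_vec_free: "hom_vec as d v \<Longrightarrow> v \<in> free (length as)"
  by (simp add: hom_vec_def)

lemma hom_vec_closed:
  "hom_vec as d 0" "hom_vec as d u \<Longrightarrow> hom_vec as d v \<Longrightarrow> hom_vec as d (u + v)"
  "hom_vec as d u \<Longrightarrow> hom_vec as d v \<Longrightarrow> hom_vec as d (u - v)"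
  "hom_vec as d u \<Longrightarrow> hom_vec as d (- u)"
  by (auto simp: hom_vec_def free_closed lookup_add lookup_minus
      intro: homogeneous_add homogeneous_diff homogeneous_uminus)

lemma hom_vec_scale:
  "homogeneous e r \<Longrightarrow> hom_vec as d v \<Longrightarrow> hom_vec as (e + d) (scale r v)"
  unfolding hom_vec_def
  by (auto simp: free_closed add_diff_eq[symmetric] intro!: homogeneous_mult)

lemma hom_vec_unit: "k < length as \<Longrightarrow> hom_vec as (as ! k) (unit k)"
  by (auto simp: hom_vec_def free_closed lookup_unit)

lemma vec_component_scale:
  assumes v: "hom_vec as e v"
  shows "vec_component as d (scale r v) = scale (hom_component (d - e) r) v"
proof (rule poly_mapping_eqI)
  fix k
  show "lookup (vec_component as d (scale r v)) k = lookup (scale (hom_component (d - e) r) v) k"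
  proof (cases "k < length as")
    case True
    then have "homogeneous (e - as ! k) (lookup v k)" using v by (simp add: hom_vec_def)
    from hom_component_mult[OF this, of "d - as ! k" r] show ?thesis
      by (simp add: lookup_vec_component)
  next
    case False
    then show ?thesis using v by (simp add: lookup_vec_component hom_vec_def free_iff)
  qed
qed

text \<open>The degree \<open>t\<close> of a map is controlled by the images of the basis vectors alone;
  \<open>graded_map_hom_vec\<close> extends this to all homogeneous vectors.\<close>

definition graded_map ::
  "int \<Rightarrow> int list \<Rightarrow> int list \<Rightarrow> (('x, 'k::field) vec \<Rightarrow> ('x, 'k) vec) \<Rightarrow> bool" where
  "graded_map t as bs f \<longleftrightarrow> module_map f \<and>
     (\<forall>k<length as. hom_vec bs (as ! k + t) (f (unit k)))"

lemma graded_map_module_map: "graded_map t as bs f \<Longrightarrow> module_map f"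
  by (simp add: graded_map_def)

lemma graded_map_free:
  assumes "graded_map t as bs f" "v \<in> free (length as)"
  shows "f v \<in> free (length bs)"
  using assms(2)
  by (induction rule: free_induct)
     (use assms(1) in \<open>auto simp: graded_map_def module_mapD hom_vec_free free_closed\<close>)

lemma graded_map_component:
  assumes f: "graded_map t as bs f" and v: "v \<in> free (length as)"
  shows "f (vec_component as d v) = vec_component bs (d + t) (f v)"
  using v
proof (induction rule: free_induct)
  case zero
  then show ?case using f by (simp add: graded_map_def module_mapD)
next
  case (add u v)
  then show ?case using f by (simp add: graded_map_def module_mapD vec_component_add)
next
  case (basis r k)
  have "hom_vec bs (as ! k + t) (f (unit k))" using f basis by (simp add: graded_map_def)
  from vec_component_scale[OF this, of "d + t" r] show ?case
    using f basis vec_component_scale[OF hom_vec_unit[OF basis], of d r]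
    by (simp add: graded_map_def module_mapD)
qed

lemma graded_map_hom_vec:
  assumes f: "graded_map t as bs f" and v: "hom_vec as d v"
  shows "hom_vec bs (d + t) (f v)"
proof -
  have "f v = vec_component bs (d + t) (f v)"
    using graded_map_component[OF f hom_vec_free[OF v], of d] vec_component_hom[OF v] by simp
  then show ?thesis
    using hom_vec_component[OF graded_map_free[OF f hom_vec_free[OF v]], of "d + t"] by simp
qed

lemma graded_map_compose:
  assumes f: "graded_map t as bs f" and g: "graded_map s bs cs g"
  shows "graded_map (t + s) as cs (\<lambda>v. g (f v))"
  using f graded_map_hom_vec[OF g] g
  by (auto simp: graded_map_def module_map_compose add.assoc[symmetric])


section \<open>Minimal resolutions as sequences of matrices\<close>

text \<open>A resolution of \<open>R/I\<close> is described without the module \<open>R/I\<close>. Stage \<open>0\<close> is the ring \<open>R\<close>,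
  viewed as the free module with the single shift \<open>0\<close>; stage \<open>Suc i\<close> is the free module in
  homological degree \<open>i\<close>. The augmentation is replaced by a map \<open>d 0\<close> into \<open>R\<close>, and all equations
  in stage \<open>0\<close> hold modulo \<open>I\<close>. The set \<open>relations I i\<close> collects what counts as zero in stage
  \<open>i\<close>, so that surjectivity of the augmentation and exactness at all later stages become one
  condition: every cycle is a boundary modulo relations. Minimality concerns only the maps
  between the free modules proper, that is, \<open>d (Suc i)\<close>.\<close>

definition graded_ideal :: "('x, 'k::field) mpoly set \<Rightarrow> bool" where
  "graded_ideal I \<longleftrightarrow> 0 \<in> I \<and> (\<forall>p\<in>I. \<forall>q\<in>I. p + q \<in> I) \<and> (\<forall>r. \<forall>q\<in>I. r * q \<in> I) \<and>
     (\<forall>d. \<forall>q\<in>I. hom_component d q \<in> I)"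

definition relations :: "('x, 'k::field) mpoly set \<Rightarrow> nat \<Rightarrow> ('x, 'k) vec set" where
  "relations I i = (if i = 0 then {v. lookup v 0 \<in> I} else {0})"

definition cycle ::
  "('x, 'k::field) mpoly set \<Rightarrow> (nat \<Rightarrow> ('x, 'k) vec \<Rightarrow> ('x, 'k) vec) \<Rightarrow> nat \<Rightarrow> ('x, 'k) vec \<Rightarrow> bool"
  where "cycle I d i v \<longleftrightarrow> (case i of 0 \<Rightarrow> True | Suc j \<Rightarrow> d j v \<in> relations I j)"

definition resolution ::
  "('x, 'k::field) mpoly set \<Rightarrow> (nat \<Rightarrow> int list) \<Rightarrow> (nat \<Rightarrow> ('x, 'k) vec \<Rightarrow> ('x, 'k) vec) \<Rightarrow> bool"
  where "resolution I L d \<longleftrightarrow>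
     L 0 = [0] \<and>
     (\<forall>i. graded_map 0 (L (Suc i)) (L i) (d i)) \<and>
     (\<forall>i. \<forall>v\<in>free (length (L (Suc i))). cycle I d i (d i v)) \<and>
     (\<forall>i. \<forall>v\<in>free (length (L i)). cycle I d i v \<longrightarrow>
        (\<exists>u\<in>free (length (L (Suc i))). d i u - v \<in> relations I i)) \<and>
     (\<forall>i. \<forall>v\<in>free (length (L (Suc (Suc i)))). \<forall>k. lookup (lookup (d (Suc i) v) k) 0 = 0)"

lemma cycle_simps [simp]:
  "cycle I d 0 v" "cycle I d (Suc i) v \<longleftrightarrow> d i v \<in> relations I i"
  by (simp_all add: cycle_def)

lemma relations_Suc [simp]: "relations I (Suc i) = {0}"
  by (simp add: relations_def)

lemma in_relations_0: "v \<in> relations I 0 \<longleftrightarrow> lookup v 0 \<in> I"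
  by (simp add: relations_def)

lemma graded_idealD:
  assumes "graded_ideal I"
  shows "0 \<in> I" "p \<in> I \<Longrightarrow> q \<in> I \<Longrightarrow> p + q \<in> I" "q \<in> I \<Longrightarrow> r * q \<in> I"
    "q \<in> I \<Longrightarrow> hom_component d q \<in> I" "q \<in> I \<Longrightarrow> - q \<in> I"
    "p \<in> I \<Longrightarrow> q \<in> I \<Longrightarrow> p - q \<in> I"
proof -
  show 1: "0 \<in> I" "p \<in> I \<Longrightarrow> q \<in> I \<Longrightarrow> p + q \<in> I" "q \<in> I \<Longrightarrow> r * q \<in> I"
    "q \<in> I \<Longrightarrow> hom_component d q \<in> I" for p q r d
    using assms by (simp_all add: graded_ideal_def)
  show m: "q \<in> I \<Longrightarrow> - q \<in> I" for q using 1(3)[of q "-1"] by simp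
  show "p \<in> I \<Longrightarrow> q \<in> I \<Longrightarrow> p - q \<in> I" using 1(2)[of p "-q"] m by simp
qed

lemma relations_closed:
  assumes "graded_ideal I"
  shows "0 \<in> relations I i" "u \<in> relations I i \<Longrightarrow> v \<in> relations I i \<Longrightarrow> u + v \<in> relations I i"
    "u \<in> relations I i \<Longrightarrow> v \<in> relations I i \<Longrightarrow> u - v \<in> relations I i"
    "v \<in> relations I i \<Longrightarrow> - v \<in> relations I i"
    "v \<in> relations I i \<Longrightarrow> scale r v \<in> relations I i"
    "v \<in> relations I i \<Longrightarrow> vec_component as d v \<in> relations I i"
  by (auto simp: relations_def lookup_add lookup_minus lookup_vec_component scale_simps
      intro: graded_idealD[OF assms])

lemma relations_trans:
  assumes "graded_ideal I" "u - v \<in> relations I i" "v - w \<in> relations I i"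
  shows "u - w \<in> relations I i"
  using relations_closed(2)[OF assms] by simp

lemma relations_cong:
  assumes "graded_ideal I" "u - v \<in> relations I i"
  shows "u \<in> relations I i \<longleftrightarrow> v \<in> relations I i"
proof
  assume "u \<in> relations I i"
  from relations_closed(3)[OF assms(1) this assms(2)] show "v \<in> relations I i" by simp
next
  assume "v \<in> relations I i"
  from relations_closed(2)[OF assms(1) this assms(2)] show "u \<in> relations I i" by simp
qed

lemma resolutionD:
  assumes "resolution I L d"
  shows "L 0 = [0]" "graded_map 0 (L (Suc i)) (L i) (d i)" "module_map (d i)"
    "v \<in> free (length (L (Suc i))) \<Longrightarrow> d i v \<in> free (length (L i))"
    "v \<in> free (length (L (Suc i))) \<Longrightarrow> cycle I d i (d i v)"
    "v \<in> free (length (L i)) \<Longrightarrow> cycle I d i v \<Longrightarrow>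
       \<exists>u\<in>free (length (L (Suc i))). d i u - v \<in> relations I i"
    "v \<in> free (length (L (Suc (Suc i)))) \<Longrightarrow> lookup (lookup (d (Suc i) v) k) 0 = 0"
proof -
  show g: "graded_map 0 (L (Suc i)) (L i) (d i)" for i
    using assms by (simp add: resolution_def)
  show "module_map (d i)" by (rule graded_map_module_map[OF g])
  show "v \<in> free (length (L (Suc i))) \<Longrightarrow> d i v \<in> free (length (L i))"
    by (rule graded_map_free[OF g])
qed (use assms in \<open>simp_all add: resolution_def\<close>)

section \<open>The comparison theorem\<close>

text \<open>Both sides are linear, so lifting the images of the basis vectors lifts the map.\<close>

lemma lift_from_basis:
  assumes J: "graded_ideal J" and e: "module_map (e i)" and f: "module_map f"
    and w: "\<And>k. k < n \<Longrightarrow> e i (w k) - f (unit k) \<in> relations J i"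
    and v: "v \<in> free n"
  shows "e i (extend w v) - f v \<in> relations J i"
proof -
  have g: "module_map (extend w)" by (rule module_map_extend)
  show ?thesis using v
  proof (induction rule: free_induct)
    case zero
    then show ?case by (simp add: module_mapD[OF e] module_mapD[OF f] module_mapD[OF g]
          relations_closed[OF J])
  next
    case (add u v)
    from relations_closed(2)[OF J add(3,4)] show ?case
      by (simp add: module_mapD[OF e] module_mapD[OF f] module_mapD[OF g] algebra_simps)
  next
    case (basis r k)
    from relations_closed(5)[OF J w[OF basis]] show ?case
      by (simp add: module_mapD[OF e] module_mapD[OF f] module_mapD[OF g] scale_simps)
  qed
qed

lemma lift_module_map:
  assumes J: "graded_ideal J" and R: "resolution J M e" and f: "module_map f"
    and c: "\<And>k. k < n \<Longrightarrow> f (unit k) \<in> free (length (M i)) \<and> cycle J e i (f (unit k))"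
  obtains g where "module_map g" "\<And>v. v \<in> free n \<Longrightarrow> g v \<in> free (length (M (Suc i)))"
    "\<And>v. v \<in> free n \<Longrightarrow> e i (g v) - f v \<in> relations J i"
proof -
  have "\<forall>k\<in>{..<n}. \<exists>w. w \<in> free (length (M (Suc i))) \<and> e i w - f (unit k) \<in> relations J i"
    using resolutionD(6)[OF R] c by blast
  then obtain w where w: "\<And>k. k < n \<Longrightarrow> w k \<in> free (length (M (Suc i)))"
      "\<And>k. k < n \<Longrightarrow> e i (w k) - f (unit k) \<in> relations J i"
    by (metis bchoice lessThan_iff)
  show thesis
  proof
    show g: "module_map (extend w)" by (rule module_map_extend)
    show "extend w v \<in> free (length (M (Suc i)))" if "v \<in> free n" for v
      using that
      by (induction rule: free_induct)
         (simp_all add: module_mapD[OF g] free_closed w)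
    show "e i (extend w v) - f v \<in> relations J i" if "v \<in> free n" for v
      using J resolutionD(3)[OF R] f w(2) that by (rule lift_from_basis)
  qed
qed

text \<open>A lift of a graded map can be made graded by keeping only the component of the right
  degree of each lifted basis vector, because the differentials and the relations are
  compatible with taking components.\<close>

lemma lift_graded_map:
  assumes J: "graded_ideal J" and R: "resolution J M e" and f: "graded_map t as (M i) f"
    and c: "\<And>k. k < length as \<Longrightarrow> cycle J e i (f (unit k))"
  obtains g where "graded_map t as (M (Suc i)) g"
    "\<And>v. v \<in> free (length as) \<Longrightarrow> e i (g v) - f v \<in> relations J i"
proof -
  have "\<exists>w. hom_vec (M (Suc i)) (as ! k + t) w \<and> e i w - f (unit k) \<in> relations J i"
    if k: "k < length as" for k
  proof -
    let ?d = "as ! k + t"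
    have fk: "hom_vec (M i) ?d (f (unit k))" using f k by (simp add: graded_map_def)
    obtain u where u: "u \<in> free (length (M (Suc i)))" "e i u - f (unit k) \<in> relations J i"
      using resolutionD(6)[OF R hom_vec_free[OF fk] c[OF k]] by blast
    have "vec_component (M i) ?d (e i u - f (unit k)) \<in> relations J i"
      by (rule relations_closed(6)[OF J u(2)])
    then have "e i (vec_component (M (Suc i)) ?d u) - f (unit k) \<in> relations J i"
      using graded_map_component[OF resolutionD(2)[OF R] u(1), of ?d]
      by (simp add: vec_component_diff vec_component_hom[OF fk])
    then show ?thesis using hom_vec_component[OF u(1)] by blast
  qed
  then have "\<forall>k\<in>{..<length as}. \<exists>w. hom_vec (M (Suc i)) (as ! k + t) w \<and>
      e i w - f (unit k) \<in> relations J i" by simp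
  then obtain w where w: "\<And>k. k < length as \<Longrightarrow> hom_vec (M (Suc i)) (as ! k + t) (w k)"
      "\<And>k. k < length as \<Longrightarrow> e i (w k) - f (unit k) \<in> relations J i"
    by (metis bchoice lessThan_iff)
  show thesis
  proof
    show "graded_map t as (M (Suc i)) (extend w)"
      by (simp add: graded_map_def module_map_extend w)
    show "e i (extend w v) - f v \<in> relations J i" if "v \<in> free (length as)" for v
      using J resolutionD(3)[OF R] graded_map_module_map[OF f] w(2) that by (rule lift_from_basis)
  qed
qed

definition chain_map ::
  "('x, 'k::field) mpoly set \<Rightarrow> (nat \<Rightarrow> int list) \<Rightarrow> (nat \<Rightarrow> int list) \<Rightarrow>
   (nat \<Rightarrow> ('x, 'k) vec \<Rightarrow> ('x, 'k) vec) \<Rightarrow> (nat \<Rightarrow> ('x, 'k) vec \<Rightarrow> ('x, 'k) vec) \<Rightarrow> int \<Rightarrow>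
   (nat \<Rightarrow> ('x, 'k) vec \<Rightarrow> ('x, 'k) vec) \<Rightarrow> bool" where
  "chain_map J L M d e t \<phi> \<longleftrightarrow>
     (\<forall>i. graded_map t (L i) (M i) (\<phi> i)) \<and>
     (\<forall>i. \<forall>v\<in>free (length (L (Suc i))). e i (\<phi> (Suc i) v) - \<phi> i (d i v) \<in> relations J i)"

text \<open>The map is built stage by stage. To lift it to the next stage, its composite with the
  differential has to consist of cycles; therefore the construction also records that cycles go to
  cycles and relations to relations.\<close>

theorem comparison:
  fixes I J :: "('x, 'k::field) mpoly set"
  assumes I: "graded_ideal I" and J: "graded_ideal J"
    and R: "resolution I L d" and S: "resolution J M e"
    and p: "homogeneous t p" and pI: "\<And>q. q \<in> I \<Longrightarrow> p * q \<in> J"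
  obtains \<phi> where "\<phi> 0 = scale p" "chain_map J L M d e t \<phi>"
proof -
  \<comment> \<open>The requirements on the map in stage \<open>i\<close> that allow the next lift.\<close>
  define good where "good i f \<longleftrightarrow> graded_map t (L i) (M i) f \<and>
      (\<forall>v\<in>relations I i. f v \<in> relations J i) \<and>
      (\<forall>v\<in>free (length (L i)). cycle I d i v \<longrightarrow> cycle J e i (f v)) \<and>
      (i = 0 \<longrightarrow> f = scale p)" for i f
  have "\<exists>\<phi>. \<forall>i. good i (\<phi> i) \<and>
    (\<forall>v\<in>free (length (L (Suc i))). e i (\<phi> (Suc i) v) - \<phi> i (d i v) \<in> relations J i)"
  proof (rule dependent_nat_choice)
    have "hom_vec [0] (0 + t) (scale p (unit 0))"
      using hom_vec_scale[OF p hom_vec_unit[of 0 "[0]"]] by simp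
    then have "graded_map t (L 0) (M 0) (scale p)"
      by (simp add: graded_map_def module_map_scale resolutionD(1)[OF R] resolutionD(1)[OF S])
    then have "good 0 (scale p)" by (simp add: good_def in_relations_0 pI)
    then show "\<exists>f. good 0 f" by blast
  next
    fix f i assume f: "good i f"
    have fd: "graded_map t (L (Suc i)) (M i) (\<lambda>v. f (d i v))"
      using graded_map_compose[OF resolutionD(2)[OF R]] f by (fastforce simp: good_def)
    have cyc: "cycle J e i (f (d i v))" if "v \<in> free (length (L (Suc i)))" for v
      using f resolutionD(4,5)[OF R that] by (simp add: good_def)
    obtain g where g: "graded_map t (L (Suc i)) (M (Suc i)) g"
      "\<And>v. v \<in> free (length (L (Suc i))) \<Longrightarrow> e i (g v) - f (d i v) \<in> relations J i"
      by (rule lift_graded_map[OF J S fd]) (auto intro: cyc free_closed)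
    have "good (Suc i) g"
      unfolding good_def
    proof (intro conjI ballI impI)
      fix v assume v: "v \<in> free (length (L (Suc i)))" "cycle I d (Suc i) v"
      then have "f (d i v) \<in> relations J i" using f by (simp add: good_def)
      then show "cycle J e (Suc i) (g v)"
        using relations_cong[OF J g(2)[OF v(1)]] by simp
    qed (use g in \<open>simp_all add: module_mapD[OF graded_map_module_map[OF g(1)]]\<close>)
    then show "\<exists>g. good (Suc i) g \<and>
      (\<forall>v\<in>free (length (L (Suc i))). e i (g v) - f (d i v) \<in> relations J i)"
      using g(2) by blast
  qed
  then obtain \<phi> where "\<And>i. good i (\<phi> i)" and
    "\<And>i v. v \<in> free (length (L (Suc i))) \<Longrightarrow> e i (\<phi> (Suc i) v) - \<phi> i (d i v) \<in> relations J i"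
    by blast
  then show thesis by (intro that[of \<phi>]) (simp_all add: chain_map_def good_def)
qed

text \<open>A chain map over the identity is homotopic to the identity. The differentials of a minimal
  resolution vanish modulo the variables, hence so does the difference \<open>d h + h d\<close> of the two maps.
  The map \<open>d 0\<close> into the ring need not vanish modulo the variables, but there \<open>h d\<close> is zero because
  the homotopy starts with zero.\<close>

theorem chain_endomorphism_diagonal:
  fixes I :: "('x, 'k::field) mpoly set"
  assumes I: "graded_ideal I" and R: "resolution I L d"
    and \<phi>: "chain_map I L L d d 0 \<phi>" and \<phi>0: "\<phi> 0 = scale 1" and k: "k < length (L (Suc i))"
  shows "lookup (lookup (\<phi> (Suc i) (unit k)) k) 0 = 1"
proof -
  note D = module_mapD[OF resolutionD(3)[OF R]]
  have \<phi>m: "module_map (\<phi> i)" for i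
    using \<phi> by (auto simp: chain_map_def intro: graded_map_module_map)
  have \<phi>F: "\<phi> i v \<in> free (length (L i))" if "v \<in> free (length (L i))" for i v
    using \<phi> that graded_map_free unfolding chain_map_def by blast
  have \<phi>c: "d i (\<phi> (Suc i) v) - \<phi> i (d i v) \<in> relations I i"
    if "v \<in> free (length (L (Suc i)))" for i v
    using \<phi> that by (simp add: chain_map_def)
  \<comment> \<open>The differential of a cycle is a relation, so vanishing on relations gives \<open>h (d v) = 0\<close>.\<close>
  define good where "good i h \<longleftrightarrow> module_map h \<and>
      (\<forall>v\<in>free (length (L i)). h v \<in> free (length (L (Suc i)))) \<and>
      (\<forall>v\<in>relations I i. h v = 0) \<and>
      (\<forall>v\<in>free (length (L i)). cycle I d i v \<longrightarrow> d i (h v) - (\<phi> i v - v) \<in> relations I i) \<and>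
      (i = 0 \<longrightarrow> h = (\<lambda>v. 0))" for i h
  have "\<exists>h. \<forall>i. good i (h i) \<and>
    (\<forall>v\<in>free (length (L (Suc i))).
        d (Suc i) (h (Suc i) v) - (\<phi> (Suc i) v - v - h i (d i v)) \<in> relations I (Suc i))"
  proof (rule dependent_nat_choice)
    have "good 0 (\<lambda>v. 0)"
      by (simp add: good_def module_map_zero free_closed \<phi>0 scale_simps D relations_closed[OF I])
    then show "\<exists>h. good 0 h" by blast
  next
    fix h i assume h: "good i h"
    have hm: "module_map h" using h by (simp add: good_def)
    \<comment> \<open>The map of which the next part of the homotopy is a lift.\<close>
    let ?f = "\<lambda>v. \<phi> (Suc i) v - v - h (d i v)"
    have fm: "module_map ?f"
      by (intro module_map_intros \<phi>m module_map_compose[OF hm] resolutionD(3)[OF R])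
    have fF: "?f v \<in> free (length (L (Suc i)))" if v: "v \<in> free (length (L (Suc i)))" for v
      using h resolutionD(4)[OF R v] v by (intro free_closed \<phi>F) (auto simp: good_def)
    have fc: "cycle I d (Suc i) (?f v)" if v: "v \<in> free (length (L (Suc i)))" for v
    proof -
      have 1: "d i (h (d i v)) - (\<phi> i (d i v) - d i v) \<in> relations I i"
        using h resolutionD(4,5)[OF R v] by (simp add: good_def)
      from relations_closed(3)[OF I \<phi>c[OF v] this] show ?thesis
        by (simp add: D algebra_simps)
    qed
    obtain g where g: "module_map g"
      "\<And>v. v \<in> free (length (L (Suc i))) \<Longrightarrow> g v \<in> free (length (L (Suc (Suc i))))"
      "\<And>v. v \<in> free (length (L (Suc i))) \<Longrightarrow> d (Suc i) (g v) - ?f v \<in> relations I (Suc i)"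
      using lift_module_map[OF I R fm, of "length (L (Suc i))" "Suc i"] fF fc free_closed(6)
      by blast
    have "good (Suc i) g"
      unfolding good_def
    proof (intro conjI ballI impI)
      fix v assume v: "v \<in> free (length (L (Suc i)))" "cycle I d (Suc i) v"
      then have "h (d i v) = 0" using h by (simp add: good_def)
      then show "d (Suc i) (g v) - (\<phi> (Suc i) v - v) \<in> relations I (Suc i)"
        using g(3)[OF v(1)] by simp
    qed (use g in \<open>simp_all add: module_mapD[OF g(1)]\<close>)
    then show "\<exists>g. good (Suc i) g \<and> (\<forall>v\<in>free (length (L (Suc i))).
        d (Suc i) (g v) - (\<phi> (Suc i) v - v - h (d i v)) \<in> relations I (Suc i))"
      using g(3) by blast
  qed
  then obtain h where h: "\<And>i. good i (h i)"
    "\<And>i v. v \<in> free (length (L (Suc i))) \<Longrightarrow>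
        d (Suc i) (h (Suc i) v) - (\<phi> (Suc i) v - v - h i (d i v)) \<in> relations I (Suc i)"
    by blast
  let ?e = "unit k :: ('x, 'k) vec"
  have e: "?e \<in> free (length (L (Suc i)))" using k by (rule free_closed)
  have eq: "\<phi> (Suc i) ?e = ?e + h i (d i ?e) + d (Suc i) (h (Suc i) ?e)"
    using h(2)[OF e] by (simp add: algebra_simps)
  have 1: "lookup (lookup (d (Suc i) (h (Suc i) ?e)) k) 0 = 0"
    using resolutionD(7)[OF R] h(1)[of "Suc i"] e by (simp add: good_def)
  have 2: "lookup (lookup (h i (d i ?e)) k) 0 = 0"
  proof (cases i)
    case 0
    then show ?thesis using h(1)[of 0] by (simp add: good_def)
  next
    case (Suc j)
    have hm: "module_map (h i)" using h(1) by (simp add: good_def)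
    have "lookup (lookup (h i u) k) 0 = 0"
      if "u \<in> free n" "\<forall>l. lookup (lookup u l) 0 = 0" for u n
    proof -
      have "h i u = extend (\<lambda>l. h i (unit l)) u"
        by (rule module_map_eqI[OF hm module_map_extend _ that(1)]) simp
      then show ?thesis
        using that(2) by (simp add: extend_def lookup_sum lookup_zero_mult)
    qed
    moreover have "\<forall>l. lookup (lookup (d i ?e) l) 0 = 0"
      using resolutionD(7)[OF R] e Suc by simp
    ultimately show ?thesis using resolutionD(4)[OF R e] by blast
  qed
  show ?thesis by (simp add: eq lookup_add 1 2 lookup_unit)
qed

text \<open>Going from one resolution to the other and back has diagonal entries with constant coefficient 1,
  so a basis vector with shift \<open>a\<close> is sent, with a nonzero constant coefficient, to some basis vector
  of the other resolution. An entry of a graded map is homogeneous of degree the difference of the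
  two shifts, and a nonzero constant coefficient forces this difference to be 0.\<close>

theorem shifts_unique:
  fixes d :: "nat \<Rightarrow> ('x, 'k::field) vec \<Rightarrow> ('x, 'k) vec"
  assumes I: "graded_ideal I" and R: "resolution I L d" and S: "resolution I M e"
  shows "set (L (Suc i)) \<subseteq> set (M (Suc i))"
proof
  fix a assume "a \<in> set (L (Suc i))"
  then obtain k where k: "k < length (L (Suc i))" "a = L (Suc i) ! k"
    by (metis in_set_conv_nth)
  obtain \<phi> where \<phi>: "\<phi> 0 = scale 1" "chain_map I L M d e 0 \<phi>"
    by (rule comparison[OF I I R S, of 0 1]) auto
  obtain \<psi> where \<psi>: "\<psi> 0 = scale 1" "chain_map I M L e d 0 \<psi>"
    by (rule comparison[OF I I S R, of 0 1]) auto
  have \<psi>m: "module_map (\<psi> i)" for i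
    using \<psi>(2) by (auto simp: chain_map_def intro: graded_map_module_map)
  have rel: "\<psi> i v \<in> relations I i" if "v \<in> relations I i" for i and v :: "('x, 'k) vec"
    using that module_mapD(3)[OF \<psi>m] by (cases i) (auto simp: \<psi>(1) scale_simps)
  have "chain_map I L L d d 0 (\<lambda>i v. \<psi> i (\<phi> i v))"
    unfolding chain_map_def
  proof (intro conjI allI ballI)
    show "graded_map 0 (L i) (L i) (\<lambda>v. \<psi> i (\<phi> i v))" for i
      using graded_map_compose[of 0 "L i" "M i" "\<phi> i" 0 "L i" "\<psi> i"] \<phi>(2) \<psi>(2)
      by (simp add: chain_map_def)
    fix i and v :: "('x, 'k) vec" assume v: "v \<in> free (length (L (Suc i)))"
    have v': "\<phi> (Suc i) v \<in> free (length (M (Suc i)))"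
      using \<phi>(2) v graded_map_free unfolding chain_map_def by blast
    have 1: "d i (\<psi> (Suc i) (\<phi> (Suc i) v)) - \<psi> i (e i (\<phi> (Suc i) v)) \<in> relations I i"
      using \<psi>(2) v' by (simp add: chain_map_def)
    have "\<psi> i (e i (\<phi> (Suc i) v) - \<phi> i (d i v)) \<in> relations I i"
      using \<phi>(2) v by (intro rel) (simp add: chain_map_def)
    then show "d i (\<psi> (Suc i) (\<phi> (Suc i) v)) - \<psi> i (\<phi> i (d i v)) \<in> relations I i"
      using relations_trans[OF I 1] by (simp add: module_mapD[OF \<psi>m])
  qed
  from chain_endomorphism_diagonal[OF I R this _ k(1)]
  have one: "lookup (lookup (\<psi> (Suc i) (\<phi> (Suc i) (unit k))) k) 0 = 1"
    using \<phi>(1) \<psi>(1) by (simp add: fun_eq_iff scale_simps)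
  define u where "u = \<phi> (Suc i) (unit k)"
  have u: "hom_vec (M (Suc i)) a u"
    using \<phi>(2) k by (auto simp: chain_map_def graded_map_def u_def)
  have "\<psi> (Suc i) u = extend (\<lambda>l. \<psi> (Suc i) (unit l)) u"
    by (rule module_map_eqI[OF \<psi>m module_map_extend _ hom_vec_free[OF u]]) simp
  then have "(\<Sum>l\<in>keys u. lookup (lookup u l) 0 * lookup (lookup (\<psi> (Suc i) (unit l)) k) 0) \<noteq> 0"
    using one by (simp add: u_def[symmetric] extend_def lookup_sum lookup_zero_mult)
  then obtain l where l: "l \<in> keys u" "lookup (lookup u l) 0 \<noteq> 0"
    by (metis (no_types, lifting) mult_zero_left sum.neutral)
  have lM: "l < length (M (Suc i))" using l(1) hom_vec_free[OF u] by (auto simp: free_def)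
  have "homogeneous (a - M (Suc i) ! l) (lookup u l)" using u lM by (simp add: hom_vec_def)
  moreover have "0 \<in> keys (lookup u l)" using l(2) by (simp add: in_keys_iff)
  ultimately have "a = M (Suc i) ! l" by (fastforce simp: homogeneous_def)
  then show "a \<in> set (M (Suc i))" using lM by simp
qed


section \<open>Monomial ideals\<close>

definition upset :: "('x \<Rightarrow>\<^sub>0 nat) set \<Rightarrow> bool" where
  "upset U \<longleftrightarrow> (\<forall>u\<in>U. \<forall>w. u + w \<in> U)"

definition monomial_ideal :: "('x \<Rightarrow>\<^sub>0 nat) set \<Rightarrow> ('x, 'k::field) mpoly set" where
  "monomial_ideal U = {p. keys p \<subseteq> U}"

abbreviation monomial :: "('x \<Rightarrow>\<^sub>0 nat) \<Rightarrow> ('x, 'k::field) mpoly" where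
  "monomial m \<equiv> Poly_Mapping.single m 1"

lemma mpoly_ring_simps [simp]:
  "carrier mpoly_ring = UNIV" "x \<otimes>\<^bsub>mpoly_ring\<^esub> y = x * y" "x \<oplus>\<^bsub>mpoly_ring\<^esub> y = x + y"
  "\<one>\<^bsub>mpoly_ring\<^esub> = 1" "\<zero>\<^bsub>mpoly_ring\<^esub> = 0"
  by (simp_all add: mpoly_ring_def)

lemma ring_mpoly_ring: "ring (mpoly_ring :: ('x, 'k::field) mpoly ring)"
  by (rule cring.axioms(1)[OF cring_mpoly_ring])

lemma a_inv_mpoly_ring [simp]: "\<ominus>\<^bsub>mpoly_ring\<^esub> p = - p"
  by (rule abelian_group.minus_equality[OF ring.is_abelian_group[OF ring_mpoly_ring]]) simp_all

lemma ideal_if_graded_ideal: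
  fixes I :: "('x, 'k::field) mpoly set"
  assumes I: "graded_ideal I"
  shows "ideal I mpoly_ring"
proof (rule idealI[OF ring_mpoly_ring])
  have "m_inv (add_monoid mpoly_ring) p = - p" for p :: "('x, 'k) mpoly"
    using a_inv_mpoly_ring[of p] by (simp add: a_inv_def)
  then show "subgroup I (add_monoid mpoly_ring)"
    by (intro subgroup.intro) (auto intro: graded_idealD[OF I])
qed (use graded_idealD(3)[OF I] in \<open>simp_all add: mult.commute\<close>)

lemma graded_ideal_monomial_ideal:
  assumes U: "upset U"
  shows "graded_ideal (monomial_ideal U)"
  unfolding graded_ideal_def
proof (intro conjI ballI allI)
  fix p q :: "('a, 'b) mpoly" and r d
  assume q: "q \<in> monomial_ideal U"
  show "r * q \<in> monomial_ideal U"
    unfolding monomial_ideal_def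
  proof (intro CollectI subsetI)
    fix m assume "m \<in> keys (r * q)"
    then obtain a b where "m = b + a" "b \<in> keys q"
      using Poly_Mapping.keys_mult[of r q] by (fastforce simp: add.commute)
    then show "m \<in> U" using U q by (auto simp: upset_def monomial_ideal_def)
  qed
  show "hom_component d q \<in> monomial_ideal U"
    using q by (auto simp: monomial_ideal_def in_keys_iff lookup_hom_component subset_iff)
  assume "p \<in> monomial_ideal U"
  then show "p + q \<in> monomial_ideal U"
    using q Poly_Mapping.keys_add[of p q] by (auto simp: monomial_ideal_def)
qed (simp add: monomial_ideal_def)

lemma monomial_expansion: "p = (\<Sum>m\<in>keys p. Poly_Mapping.single m (lookup p m))"
proof (rule poly_mapping_eqI)
  fix j
  have "lookup (\<Sum>m\<in>keys p. Poly_Mapping.single m (lookup p m)) j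
      = (\<Sum>m\<in>keys p. if m = j then lookup p m else 0)"
    by (simp add: lookup_sum lookup_single when_def)
  also have "\<dots> = lookup p j" by (auto simp: in_keys_iff)
  finally show "lookup p j = lookup (\<Sum>m\<in>keys p. Poly_Mapping.single m (lookup p m)) j" by simp
qed

lemma genideal_monomials:
  fixes S :: "('x \<Rightarrow>\<^sub>0 nat) set"
  shows "Idl\<^bsub>mpoly_ring\<^esub> (monomial ` S) = (monomial_ideal {m + w | m w. m \<in> S} :: ('x, 'k::field) mpoly set)"
    (is "?G = monomial_ideal ?U")
proof
  have "upset ?U" unfolding upset_def by (auto simp: add.assoc) blast
  then have id: "ideal (monomial_ideal ?U :: ('x, 'k) mpoly set) mpoly_ring"
    by (intro ideal_if_graded_ideal graded_ideal_monomial_ideal)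
  have "m \<in> ?U" if "m \<in> S" for m using that by (metis (mono_tags, lifting) add.right_neutral mem_Collect_eq)
  then have "monomial ` S \<subseteq> (monomial_ideal ?U :: ('x, 'k) mpoly set)"
    by (auto simp: monomial_ideal_def)
  then show "?G \<subseteq> monomial_ideal ?U"
    by (rule ring.genideal_minimal[OF ring_mpoly_ring id])
next
  have G: "ideal ?G mpoly_ring"
    by (rule ring.genideal_ideal[OF ring_mpoly_ring]) simp
  have zero: "0 \<in> ?G" using additive_subgroup.zero_closed[OF ideal.axioms(1)[OF G]] by simp
  have add: "p + q \<in> ?G" if "p \<in> ?G" "q \<in> ?G" for p q
    using additive_subgroup.a_closed[OF ideal.axioms(1)[OF G] that] by simp
  have mult: "r * q \<in> ?G" if "q \<in> ?G" for r q
    using ideal.I_l_closed[OF G that, of r] by simp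
  have gen: "monomial m \<in> ?G" if "m \<in> S" for m
    using ring.genideal_self[OF ring_mpoly_ring, of "monomial ` S"] that by auto
  have single: "Poly_Mapping.single u c \<in> ?G" if u: "u \<in> ?U" for u c
  proof -
    obtain m w where mw: "u = m + w" "m \<in> S" using u by blast
    have "Poly_Mapping.single u c = Poly_Mapping.single w c * monomial m"
      by (simp add: mw mult_single add.commute)
    then show ?thesis using mult[OF gen[OF mw(2)]] by simp
  qed
  show "monomial_ideal ?U \<subseteq> ?G"
  proof
    fix p :: "('x, 'k) mpoly" assume "p \<in> monomial_ideal ?U"
    then have p: "keys p \<subseteq> ?U" by (simp add: monomial_ideal_def)
    have "(\<Sum>m\<in>A. Poly_Mapping.single m (lookup p m)) \<in> ?G" if "finite A" "A \<subseteq> keys p" for A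
      using that
    proof (induction A)
      case (insert m A)
      then have "Poly_Mapping.single m (lookup p m) \<in> ?G" using p by (intro single) auto
      then show ?case using insert by (simp add: add)
    qed (simp add: zero)
    from this[of "keys p"] show "p \<in> ?G" using monomial_expansion[of p] by simp
  qed
qed

lemma monomial_remove_var:
  assumes "0 < lookup u i"
  obtains w where "u = Poly_Mapping.single i 1 + (w :: 'x \<Rightarrow>\<^sub>0 nat)"
proof
  show "u = Poly_Mapping.single i 1 + (u - Poly_Mapping.single i 1)"
    using assms by (intro poly_mapping_eqI) (auto simp: lookup_add lookup_minus lookup_single when_def)
qed

lemma irrelevant_ideal_iff:
  fixes p :: "('x, 'k::field) mpoly"
  shows "p \<in> irrelevant_ideal \<longleftrightarrow> lookup p 0 = 0"
proof -
  have "(range Var :: ('x, 'k) mpoly set) = monomial ` range (\<lambda>i. Poly_Mapping.single i 1)"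
    by (auto simp: Var_def)
  then have "(irrelevant_ideal :: ('x, 'k) mpoly set) = monomial_ideal {m + w | m w. m \<in> range (\<lambda>i. Poly_Mapping.single i 1)}"
    unfolding irrelevant_ideal_def by (simp only: genideal_monomials)
  also have "{m + w | m w. m \<in> range (\<lambda>i::'x. Poly_Mapping.single i (1::nat))} = {u. u \<noteq> 0}"
  proof (intro Set.set_eqI iffI)
    fix u assume "u \<in> {m + w | m w. m \<in> range (\<lambda>i::'x. Poly_Mapping.single i (1::nat))}"
    then obtain i w where "u = Poly_Mapping.single i 1 + w" by blast
    then have "lookup u i \<noteq> 0" by (simp add: lookup_add)
    then show "u \<in> {u. u \<noteq> 0}" by auto
  next
    fix u :: "'x \<Rightarrow>\<^sub>0 nat" assume "u \<in> {u. u \<noteq> 0}"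
    then obtain i where "0 < lookup u i" by (metis gr0I mem_Collect_eq poly_mapping_eqI lookup_zero)
    then show "u \<in> {m + w | m w. m \<in> range (\<lambda>i::'x. Poly_Mapping.single i (1::nat))}"
    proof (rule monomial_remove_var)
      fix w assume "u = Poly_Mapping.single i 1 + w"
      then show "u \<in> {m + w | m w. m \<in> range (\<lambda>i::'x. Poly_Mapping.single i (1::nat))}"
        by blast
    qed
  qed
  finally show ?thesis by (auto simp: monomial_ideal_def subset_iff in_keys_iff)
qed

section \<open>Minimal graded free resolutions of quotient rings\<close>

abbreviation coset :: "('x, 'k::field) mpoly set \<Rightarrow> ('x, 'k) mpoly \<Rightarrow> ('x, 'k) mpoly set" where
  "coset I p \<equiv> I +>\<^bsub>mpoly_ring\<^esub> p"

lemma coset_eq_iff: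
  assumes "ideal I mpoly_ring"
  shows "coset I p = coset I q \<longleftrightarrow> p - q \<in> I"
  using ring.quotient_eq_iff_same_a_r_cos[OF ring_mpoly_ring assms, of p q]
  by (simp add: a_minus_def)

lemma quotient_module_simps:
  assumes I: "ideal I mpoly_ring"
  shows "carrier (quotient_module I) = range (coset I)"
    "coset I p \<oplus>\<^bsub>quotient_module I\<^esub> coset I q = coset I (p + q)"
    "r \<odot>\<^bsub>quotient_module I\<^esub> coset I p = coset I (r * p)"
    "\<zero>\<^bsub>quotient_module I\<^esub> = coset I 0"
    "graded_part (quotient_module I) d = {coset I p | p. homogeneous d p}"
proof -
  note h = ideal.rcos_ring_hom[OF I]
  show "carrier (quotient_module I) = range (coset I)"
    by (auto simp: quotient_module_def FactRing_def A_RCOSETS_def' )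
  show "coset I p \<oplus>\<^bsub>quotient_module I\<^esub> coset I q = coset I (p + q)"
    using ring_hom_add[OF h, of p q] by (simp add: quotient_module_def)
  show "r \<odot>\<^bsub>quotient_module I\<^esub> coset I p = coset I (r * p)"
    using ring_hom_mult[OF h, of r p] by (simp add: quotient_module_def)
  show "\<zero>\<^bsub>quotient_module I\<^esub> = coset I 0"
    using ring.a_rcos_zero[OF ring_mpoly_ring I additive_subgroup.zero_closed[OF ideal.axioms(1)[OF I]]]
    by (simp add: quotient_module_def FactRing_def)
qed (simp add: quotient_module_def)

lemma graded_free_simps:
  "carrier (graded_free as) = free (length as)" "u \<oplus>\<^bsub>graded_free as\<^esub> v = u + v"
  "r \<odot>\<^bsub>graded_free as\<^esub> v = scale r v" "\<zero>\<^bsub>graded_free as\<^esub> = 0"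
  "graded_part (graded_free as) d = {v. hom_vec as d v}"
  by (simp_all add: graded_free_def free_def scale_def hom_vec_def)

lemma graded_hom_free_if_graded_map:
  "graded_map 0 as bs f \<Longrightarrow> f \<in> graded_hom (graded_free as) (graded_free bs)"
  using graded_map_free[of 0 as bs f] graded_map_hom_vec[of 0 as bs f]
  by (auto simp: graded_hom_def graded_free_simps module_mapD[OF graded_map_module_map])

lemma graded_map_if_graded_hom_free:
  assumes h: "h \<in> graded_hom (graded_free as) (graded_free bs)"
  shows "graded_map 0 as bs (extend (\<lambda>k. h (unit k)))"
    "v \<in> free (length as) \<Longrightarrow> extend (\<lambda>k. h (unit k)) v = h v"
proof -
  have add: "h (u + v) = h u + h v" if "u \<in> free (length as)" "v \<in> free (length as)" for u v
    using h that by (simp add: graded_hom_def graded_free_simps)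
  have sc: "h (scale r v) = scale r (h v)" if "v \<in> free (length as)" for r v
    using h that by (simp add: graded_hom_def graded_free_simps)
  have "hom_vec bs (as ! k) (h (unit k))" if "k < length as" for k
    using h hom_vec_unit[OF that] unfolding graded_hom_def graded_free_simps by blast
  then show "graded_map 0 as bs (extend (\<lambda>k. h (unit k)))"
    by (simp add: graded_map_def module_map_extend)
  note D = module_mapD[OF module_map_extend]
  show "extend (\<lambda>k. h (unit k)) v = h v" if "v \<in> free (length as)"
    using that
  proof (induction rule: free_induct)
    case zero
    show ?case using sc[OF free_closed(1), of 0] by (simp add: scale_simps D)
  qed (simp_all add: D add sc free_closed)
qed

text \<open>Exactness at the augmentation is exactness at the first two stages: surjectivity onto \<open>R/I\<close> in
  stage \<open>0\<close>, and in stage \<open>1\<close> the kernel, the vectors that \<open>d 0\<close> sends into \<open>I\<close>.\<close>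

lemma minimal_graded_free_resolution_if_resolution:
  assumes I: "graded_ideal I" and R: "resolution I L d"
  shows "minimal_graded_free_resolution (quotient_module I) (\<lambda>i. L (Suc i)) (\<lambda>i. d (Suc i))
    (\<lambda>v. coset I (lookup (d 0 v) 0))"
proof -
  note id = ideal_if_graded_ideal[OF I]
  note Q = quotient_module_simps[OF id]
  note D = module_mapD[OF resolutionD(3)[OF R]]
  note gh = graded_hom_free_if_graded_map[OF resolutionD(2)[OF R]]
  have L0: "L 0 = [0]" by (rule resolutionD(1)[OF R])
  have zero: "coset I p = coset I 0 \<longleftrightarrow> p \<in> I" for p using coset_eq_iff[OF id, of p 0] by simp
  have aug: "(\<lambda>v. coset I (lookup (d 0 v) 0)) \<in> graded_hom (graded_free (L (Suc 0))) (quotient_module I)"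
  proof -
    have "homogeneous e (lookup (d 0 v) 0)" if "hom_vec (L (Suc 0)) e v" for e v
      using graded_map_hom_vec[OF resolutionD(2)[OF R] that] by (simp add: L0 hom_vec_def)
    then show ?thesis
      by (auto simp: graded_hom_def graded_free_simps Q D lookup_add)
  qed
  have surj: "(\<lambda>v. coset I (lookup (d 0 v) 0)) ` free (length (L (Suc 0))) = range (coset I)"
  proof (intro equalityI subsetI)
    fix X assume "X \<in> range (coset I)"
    then obtain p where p: "X = coset I p" by blast
    have "scale p (unit 0) \<in> free (length (L 0))" by (simp add: L0 free_closed)
    from resolutionD(6)[OF R this] obtain u where
      u: "u \<in> free (length (L (Suc 0)))" "d 0 u - scale p (unit 0) \<in> relations I 0" by auto
    then have "coset I (lookup (d 0 u) 0) = X"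
      by (simp add: p coset_eq_iff[OF id] in_relations_0 lookup_minus lookup_unit)
    then show "X \<in> (\<lambda>v. coset I (lookup (d 0 v) 0)) ` free (length (L (Suc 0)))" using u(1) by blast
  qed auto
  have ex: "d (Suc i) ` free (length (L (Suc (Suc i)))) =
      {v \<in> free (length (L (Suc i))). d i v \<in> relations I i}" for i
  proof (intro equalityI subsetI)
    fix v assume "v \<in> {v \<in> free (length (L (Suc i))). d i v \<in> relations I i}"
    then obtain u where "u \<in> free (length (L (Suc (Suc i))))" "d (Suc i) u - v \<in> relations I (Suc i)"
      using resolutionD(6)[OF R, of v "Suc i"] by auto
    then show "v \<in> d (Suc i) ` free (length (L (Suc (Suc i))))" by force
  next
    fix v assume "v \<in> d (Suc i) ` free (length (L (Suc (Suc i))))"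
    then show "v \<in> {v \<in> free (length (L (Suc i))). d i v \<in> relations I i}"
      using resolutionD(4,5)[OF R] by (fastforce simp del: relations_Suc)
  qed
  show ?thesis
    unfolding minimal_graded_free_resolution_def graded_free_simps hom_kernel_def Q
    using aug surj gh ex[of 0] ex resolutionD(7)[OF R]
    by (simp add: zero in_relations_0 irrelevant_ideal_iff)
qed

text \<open>The given maps are meaningful only on the carriers. They are replaced by the linear maps with the
  same values on the basis vectors, and the augmentation by a linear map into \<open>R\<close> that sends each
  basis vector to a homogeneous representative of its image.\<close>

lemma resolution_if_minimal_graded_free_resolution:
  assumes I: "graded_ideal I"
    and M: "minimal_graded_free_resolution (quotient_module I) a \<delta> \<epsilon>"
  shows "\<exists>d. resolution I (case_nat [0] a) d"
proof -
  note id = ideal_if_graded_ideal[OF I]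
  note Q = quotient_module_simps[OF id]
  have zero: "coset I p = coset I 0 \<longleftrightarrow> p \<in> I" for p using coset_eq_iff[OF id, of p 0] by simp
  have \<epsilon>: "\<epsilon> \<in> graded_hom (graded_free (a 0)) (quotient_module I)"
    and \<delta>: "\<And>i. \<delta> i \<in> graded_hom (graded_free (a (Suc i))) (graded_free (a i))"
    and surj: "\<epsilon> ` free (length (a 0)) = range (coset I)"
    and ex0: "\<delta> 0 ` free (length (a 1)) = {v \<in> free (length (a 0)). \<epsilon> v = coset I 0}"
    and ex: "\<And>i. \<delta> (Suc i) ` free (length (a (Suc (Suc i)))) =
        {v \<in> free (length (a (Suc i))). \<delta> i v = 0}"
    and min: "\<And>i v k. v \<in> free (length (a (Suc i))) \<Longrightarrow> lookup (lookup (\<delta> i v) k) 0 = 0"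
    using M unfolding minimal_graded_free_resolution_def graded_free_simps hom_kernel_def Q
      irrelevant_ideal_iff by simp_all
  have "\<forall>k\<in>{..<length (a 0)}. \<exists>p. homogeneous (a 0 ! k) p \<and> \<epsilon> (unit k) = coset I p"
  proof
    fix k assume "k \<in> {..<length (a 0)}"
    then have "hom_vec (a 0) (a 0 ! k) (unit k)" by (simp add: hom_vec_unit)
    then have "unit k \<in> graded_part (graded_free (a 0)) (a 0 ! k)" by (simp only: graded_free_simps mem_Collect_eq)
    moreover have "\<epsilon> ` graded_part (graded_free (a 0)) (a 0 ! k) \<subseteq> graded_part (quotient_module I) (a 0 ! k)"
      using \<epsilon> unfolding graded_hom_def mem_Collect_eq by (elim conjE allE)
    ultimately have "\<epsilon> (unit k) \<in> graded_part (quotient_module I) (a 0 ! k)" by (rule image_subset_iff[THEN iffD1, THEN bspec, rotated])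
    then show "\<exists>p. homogeneous (a 0 ! k) p \<and> \<epsilon> (unit k) = coset I p" unfolding Q by blast
  qed
  then obtain r where "\<forall>k\<in>{..<length (a 0)}. homogeneous (a 0 ! k) (r k) \<and> \<epsilon> (unit k) = coset I (r k)"
    by (rule bchoice[THEN exE])
  then have r: "\<And>k. k < length (a 0) \<Longrightarrow> homogeneous (a 0 ! k) (r k)"
      "\<And>k. k < length (a 0) \<Longrightarrow> \<epsilon> (unit k) = coset I (r k)"
    by simp_all
  define d where "d i = (case i of 0 \<Rightarrow> extend (\<lambda>k. scale (r k) (unit 0))
      | Suc j \<Rightarrow> extend (\<lambda>k. \<delta> j (unit k)))" for i
  let ?L = "case_nat [0] a"
  have dm: "module_map (d i)" for i by (cases i) (simp_all add: d_def module_map_extend)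
  note D = module_mapD[OF dm]
  have g: "graded_map 0 (?L (Suc i)) (?L i) (d i)" for i
  proof (cases i)
    case 0
    have "hom_vec [0] (a 0 ! k) (scale (r k) (unit 0))" if "k < length (a 0)" for k
      using hom_vec_scale[OF r(1)[OF that] hom_vec_unit[of 0 "[0]"]] by simp
    then show ?thesis by (simp add: 0 d_def graded_map_def module_map_extend)
  next
    case (Suc j)
    then show ?thesis using graded_map_if_graded_hom_free(1)[OF \<delta>[of j]] by (simp add: d_def)
  qed
  have dS: "d (Suc i) v = \<delta> i v" if "v \<in> free (length (a (Suc i)))" for i v
    using graded_map_if_graded_hom_free(2)[OF \<delta> that] by (simp add: d_def)
  have d0: "\<epsilon> v = coset I (lookup (d 0 v) 0)" if "v \<in> free (length (a 0))" for v
  proof -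
    have plus: "\<epsilon> (u + v) = \<epsilon> u \<oplus>\<^bsub>quotient_module I\<^esub> \<epsilon> v"
      if "u \<in> free (length (a 0))" "v \<in> free (length (a 0))" for u v
      using \<epsilon> that by (simp add: graded_hom_def graded_free_simps)
    have sc: "\<epsilon> (scale r v) = r \<odot>\<^bsub>quotient_module I\<^esub> \<epsilon> v" if "v \<in> free (length (a 0))" for r v
      using \<epsilon> that by (simp add: graded_hom_def graded_free_simps)
    show ?thesis using that
    proof (induction rule: free_induct)
      case zero
      have "\<epsilon> 0 \<in> range (coset I)" by (simp add: surj[symmetric] free_closed)
      then obtain p where "\<epsilon> 0 = coset I p" by blast
      then show ?case using sc[OF free_closed(1), of 0] by (simp add: scale_simps D Q)
    next
      case (add u v)
      then show ?case by (simp add: plus D Q lookup_add)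
    next
      case (basis q k)
      then show ?case by (simp add: sc free_closed r Q D) (simp add: d_def lookup_unit)
    qed
  qed
  have rel0: "d 0 v \<in> relations I 0 \<longleftrightarrow> \<epsilon> v = coset I 0" if "v \<in> free (length (a 0))" for v
    by (simp add: in_relations_0 d0[OF that] zero)
  have "resolution I ?L d"
    unfolding resolution_def
  proof (intro conjI allI ballI impI)
    show "?L 0 = [0]" by simp
    show "graded_map 0 (?L (Suc i)) (?L i) (d i)" for i by (rule g)
  next
    fix i and v :: "('a, 'b) vec" assume v: "v \<in> free (length (?L (Suc i)))"
    consider "i = 0" | "i = 1" | j where "i = Suc (Suc j)" by (metis One_nat_def not0_implies_Suc)
    then show "cycle I d i (d i v)"
    proof cases
      case 2
      have "\<delta> 0 v \<in> {v \<in> free (length (a 0)). \<epsilon> v = coset I 0}"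
        using v 2 by (subst ex0[symmetric]) simp
      then show ?thesis using v 2 by (simp add: dS rel0)
    next
      case (3 j)
      have "\<delta> (Suc j) v \<in> {v \<in> free (length (a (Suc j))). \<delta> j v = 0}"
        using v 3 by (subst ex[symmetric]) simp
      then show ?thesis using v 3 by (simp add: dS)
    qed simp
  next
    fix i and v :: "('a, 'b) vec" assume v: "v \<in> free (length (?L i))" "cycle I d i v"
    consider "i = 0" | "i = 1" | j where "i = Suc (Suc j)" by (metis One_nat_def not0_implies_Suc)
    then show "\<exists>u\<in>free (length (?L (Suc i))). d i u - v \<in> relations I i"
    proof cases
      case 1
      have "coset I (lookup v 0) \<in> \<epsilon> ` free (length (a 0))" by (simp add: surj)
      then obtain u where u: "u \<in> free (length (a 0))" "coset I (lookup v 0) = coset I (lookup (d 0 u) 0)"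
        using d0 by auto
      then have "lookup (d 0 u) 0 - lookup v 0 \<in> I" using coset_eq_iff[OF id] by metis
      then show ?thesis using u(1) 1 by (auto simp: in_relations_0 lookup_minus)
    next
      case 2
      have "v \<in> \<delta> 0 ` free (length (a 1))" using v 2 by (simp add: ex0[unfolded One_nat_def] rel0)
      then show ?thesis using 2 dS[of _ 0] by auto
    next
      case (3 j)
      have "v \<in> \<delta> (Suc j) ` free (length (a (Suc (Suc j))))" using v 3 by (simp add: ex dS)
      then show ?thesis using 3 dS[of _ "Suc j"] by auto
    qed
  next
    fix i k and v :: "('a, 'b) vec" assume "v \<in> free (length (?L (Suc (Suc i))))"
    then show "lookup (lookup (d (Suc i) v) k) 0 = 0" by (simp add: dS min)
  qed
  then show ?thesis by blast
qed

text \<open>By the uniqueness of the shifts, one resolution in the matrix form above determines which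
  graded Betti numbers vanish.\<close>

theorem graded_betti_nonzero_iff:
  assumes I: "graded_ideal I" and R: "resolution I L d"
  shows "graded_betti (quotient_module I) i j \<noteq> 0 \<longleftrightarrow> j \<in> set (L (Suc i))"
proof -
  define a where "a = (SOME a. \<exists>\<delta> \<epsilon>. minimal_graded_free_resolution (quotient_module I) a \<delta> \<epsilon>)"
  have "\<exists>a \<delta> \<epsilon>. minimal_graded_free_resolution (quotient_module I) a \<delta> \<epsilon>"
    using minimal_graded_free_resolution_if_resolution[OF I R] by blast
  then have "\<exists>\<delta> \<epsilon>. minimal_graded_free_resolution (quotient_module I) a \<delta> \<epsilon>"
    unfolding a_def by (rule someI_ex)
  then obtain e where S: "resolution I (case_nat [0] a) e"
    using resolution_if_minimal_graded_free_resolution[OF I] by blast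
  have "set (a i) = set (L (Suc i))"
    using shifts_unique[OF I R S, of i] shifts_unique[OF I S R, of i] by simp
  then show ?thesis
    by (simp add: graded_betti_def a_def[symmetric] count_list_0_iff)
qed


section \<open>Direct sums of free modules\<close>

text \<open>The module \<open>free (n + m)\<close> is the direct sum of \<open>free n\<close> and \<open>free m\<close>: the first summand is
  included identically, the second one by \<open>raise n\<close>, and \<open>low n\<close> and \<open>high n\<close> are the
  projections.\<close>

definition low :: "nat \<Rightarrow> ('x, 'k::field) vec \<Rightarrow> ('x, 'k) vec" where
  "low n = extend (\<lambda>k. if k < n then unit k else 0)"

definition high :: "nat \<Rightarrow> ('x, 'k::field) vec \<Rightarrow> ('x, 'k) vec" where
  "high n = extend (\<lambda>k. if k < n then 0 else unit (k - n))"

definition raise :: "nat \<Rightarrow> ('x, 'k::field) vec \<Rightarrow> ('x, 'k) vec" where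
  "raise n = extend (\<lambda>k. unit (k + n))"

lemma lookup_extend_select:
  assumes "\<And>k. lookup (c k) j = (if k = m then 1 else 0)"
  shows "lookup (extend c v) j = lookup v m"
proof -
  have "lookup (extend c v) j = (\<Sum>k\<in>keys v. if k = m then lookup v k else 0)"
    unfolding extend_def lookup_sum lookup_scale by (rule sum.cong) (simp_all add: assms)
  also have "\<dots> = lookup v m" by (auto simp: in_keys_iff)
  finally show ?thesis .
qed

lemma lookup_extend_none:
  assumes "\<And>k. lookup (c k) j = 0"
  shows "lookup (extend c v) j = 0"
  by (simp add: extend_def lookup_sum assms)

lemma lookup_low: "lookup (low n v) j = (if j < n then lookup v j else 0)"
  unfolding low_def
  by (auto intro!: lookup_extend_select lookup_extend_none simp: lookup_unit)

lemma lookup_high: "lookup (high n v) j = lookup v (j + n)"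
  unfolding high_def by (rule lookup_extend_select) (auto simp: lookup_unit)

lemma lookup_raise: "lookup (raise n v) j = (if j < n then 0 else lookup v (j - n))"
  unfolding raise_def
  by (auto intro!: lookup_extend_select lookup_extend_none simp: lookup_unit)

lemma module_map_split: "module_map (low n)" "module_map (high n)" "module_map (raise n)"
  by (simp_all add: low_def high_def raise_def module_map_extend)

lemmas split_simps = module_mapD[OF module_map_split(1)] module_mapD[OF module_map_split(2)]
  module_mapD[OF module_map_split(3)]

lemma low_raise_high: "v = low n v + raise n (high n v)"
  by (rule poly_mapping_eqI) (simp add: lookup_add lookup_low lookup_high lookup_raise)

lemma low_raise: "low n (raise n w) = 0" and high_raise: "high n (raise n w) = w"
  by (rule poly_mapping_eqI; simp add: lookup_low lookup_high lookup_raise)+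

lemma low_free: "u \<in> free n \<Longrightarrow> low n u = u" and high_free: "u \<in> free n \<Longrightarrow> high n u = 0"
  by (rule poly_mapping_eqI; simp add: lookup_low lookup_high free_iff)+

lemma split_free:
  "low n v \<in> free n" "v \<in> free (n + m) \<Longrightarrow> high n v \<in> free m"
  "w \<in> free m \<Longrightarrow> raise n w \<in> free (n + m)" "u \<in> free n \<Longrightarrow> u \<in> free (n + m)"
  by (auto simp: free_iff lookup_low lookup_high lookup_raise)

lemma hom_vec_append: "hom_vec as d u \<Longrightarrow> hom_vec (as @ bs) d u"
  by (auto simp: hom_vec_def split_free nth_append free_iff)

lemma hom_vec_raise: "hom_vec bs d w \<Longrightarrow> hom_vec (as @ bs) d (raise (length as) w)"
  by (auto simp: hom_vec_def split_free nth_append lookup_raise)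

lemma hom_vec_shift: "hom_vec bs d w \<Longrightarrow> hom_vec (map (\<lambda>b. b + c) bs) (d + c) w"
  by (simp add: hom_vec_def)

section \<open>The mapping cone\<close>

text \<open>Homological degree \<open>i\<close> of the cone consists of degree \<open>i\<close> of the first resolution and degree
  \<open>i - 1\<close> of the second one. As stage \<open>0\<close> is the ring and not part of a resolution, the second
  summand starts in stage \<open>2\<close>.\<close>

definition cone_shifts :: "int \<Rightarrow> (nat \<Rightarrow> int list) \<Rightarrow> (nat \<Rightarrow> int list) \<Rightarrow> nat \<Rightarrow> int list" where
  "cone_shifts c L M i = L i @
     (case i of 0 \<Rightarrow> [] | Suc j \<Rightarrow> (case j of 0 \<Rightarrow> [] | Suc _ \<Rightarrow> map (\<lambda>b. b + c) (M j)))"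

lemma cone_shifts_simps [simp]:
  "cone_shifts c L M 0 = L 0" "cone_shifts c L M (Suc 0) = L (Suc 0)"
  "cone_shifts c L M (Suc (Suc j)) = L (Suc (Suc j)) @ map (\<lambda>b. b + c) (M (Suc j))"
  by (simp_all add: cone_shifts_def)

text \<open>The assumptions say that \<open>B\<close> is the colon ideal \<open>A : zp\<close> and that \<open>p\<close> alone already maps \<open>B\<close>
  into \<open>A\<close>. The first makes \<open>0 \<rightarrow> R/B \<rightarrow> R/A \<rightarrow> R/(A + (zp)) \<rightarrow> 0\<close>, with multiplication by \<open>zp\<close>,
  exact, so that the mapping cone is a resolution. The second gives a chain map \<open>\<phi>\<close> over
  multiplication by \<open>p\<close>, and the cone is taken over \<open>z \<phi>\<close>, whose matrices vanish modulo the
  variables whether or not those of \<open>\<phi>\<close> do: the cone is minimal.\<close>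

theorem mapping_cone:
  fixes A B :: "('x, 'k::field) mpoly set"
  assumes A: "graded_ideal A" and B: "graded_ideal B"
    and R: "resolution A L d" and S: "resolution B M e"
    and p: "homogeneous t p" and z: "homogeneous 1 z"
    and pB: "\<And>q. q \<in> B \<Longrightarrow> p * q \<in> A" and colon: "\<And>q. z * p * q \<in> A \<Longrightarrow> q \<in> B"
  shows "\<exists>D. resolution {a + r * (z * p) | a r. a \<in> A} (cone_shifts (t + 1) L M) D"
proof -
  let ?C = "{a + r * (z * p) | a r. a \<in> A}" and ?T = "cone_shifts (t + 1) L M"
  obtain \<phi> where \<phi>0: "\<phi> 0 = scale p" and \<phi>: "chain_map A M L e d t \<phi>"
    by (rule comparison[OF B A S R p pB])
  have \<phi>g: "graded_map t (M i) (L i) (\<phi> i)" for i using \<phi> by (simp add: chain_map_def)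
  have \<phi>c: "d i (\<phi> (Suc i) w) - \<phi> i (e i w) \<in> relations A i" if "w \<in> free (length (M (Suc i)))" for i w
    using \<phi> that by (simp add: chain_map_def)
  have \<phi>m: "module_map (\<phi> i)" for i by (rule graded_map_module_map[OF \<phi>g])
  have \<phi>F: "\<phi> i w \<in> free (length (L i))" if "w \<in> free (length (M i))" for i w
    using graded_map_free[OF \<phi>g that] .
  note dm = resolutionD(3)[OF R] and em = resolutionD(3)[OF S]
  note dF = resolutionD(4)[OF R] and eF = resolutionD(4)[OF S]
  note lin = module_mapD[OF dm] module_mapD[OF em] module_mapD[OF \<phi>m] split_simps
  have L0: "L 0 = [0]" and M0: "M 0 = [0]" by (rule resolutionD(1)[OF R], rule resolutionD(1)[OF S])
  have z0: "lookup z 0 = 0" using z unfolding homogeneous_def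
    by (metis in_keys_iff monom_degree_zero of_nat_0 zero_neq_one)

  have dd0: "lookup (d 0 (d 1 u)) 0 \<in> A" if "u \<in> free (length (L (Suc (Suc 0))))" for u
    using resolutionD(5)[OF R that] by (simp add: in_relations_0)
  have dd: "d (Suc j) (d (Suc (Suc j)) u) = 0" if "u \<in> free (length (L (Suc (Suc (Suc j)))))" for j u
    using resolutionD(5)[OF R that] by simp
  have ee: "e (Suc j) (e (Suc (Suc j)) w) = 0" if "w \<in> free (length (M (Suc (Suc (Suc j)))))" for j w
    using resolutionD(5)[OF S that] by simp
  have \<phi>c0: "lookup (d 0 (\<phi> 1 w)) 0 - p * lookup (e 0 w) 0 \<in> A" if "w \<in> free (length (M (Suc 0)))" for w
    using \<phi>c[OF that] by (simp add: in_relations_0 \<phi>0 lookup_minus)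
  have \<phi>cS: "d (Suc j) (\<phi> (Suc (Suc j)) w) = \<phi> (Suc j) (e (Suc j) w)"
    if "w \<in> free (length (M (Suc (Suc j))))" for j w
    using \<phi>c[OF that] by simp

  define n where "n j = length (L j)" for j
  \<comment> \<open>The map \<open>e 0\<close> is an augmentation into the ring, which the cone does not contain.\<close>
  define E where "E j = (if j = 0 then (\<lambda>w. 0) else (\<lambda>w. raise (n (Suc j)) (e j w)))" for j
  define D' where "D' j u w = d (Suc j) u + scale z (\<phi> (Suc j) w) - E j w" for j u w
  define D where "D i = (case i of 0 \<Rightarrow> d 0
      | Suc j \<Rightarrow> (\<lambda>v. D' j (low (n (Suc (Suc j))) v) (high (n (Suc (Suc j))) v)))" for i
  have D0: "D 0 = d 0" by (simp add: D_def)
  have Em: "module_map (E j)" for j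
    using module_map_compose[OF module_map_split(3) em] by (simp add: E_def module_map_zero)
  have Dm: "module_map (D i)" for i
    by (cases i)
      (simp_all add: D_def D'_def dm module_map_intros module_map_compose[OF dm]
        module_map_compose[OF module_map_scale] module_map_compose[OF \<phi>m]
        module_map_compose[OF Em] module_map_split)
  have DS: "D (Suc j) (u + raise (n (Suc (Suc j))) w) = D' j u w"
    if "u \<in> free (n (Suc (Suc j)))" for j u w
    using that by (simp add: D_def split_simps low_raise high_raise low_free high_free)
  have split: "\<exists>u w. u \<in> free (n (Suc (Suc j))) \<and> w \<in> free (length (M (Suc j))) \<and>
      v = u + raise (n (Suc (Suc j))) w" if "v \<in> free (length (?T (Suc (Suc j))))" for j v
    using split_free(1,2)[where n = "n (Suc (Suc j))" and v = v] that low_raise_high[of v "n (Suc (Suc j))"]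
    by (auto simp: n_def)
  have join: "u + raise (n (Suc (Suc j))) w \<in> free (length (?T (Suc (Suc j))))"
    if "u \<in> free (n (Suc (Suc j)))" "w \<in> free (length (M (Suc j)))" for j u w
    using free_closed(2)[OF split_free(4)[OF that(1)] split_free(3)[OF that(2)]] by (simp add: n_def)

  have graded: "graded_map 0 (?T (Suc i)) (?T i) (D i)" for i
  proof (cases i)
    case 0
    then show ?thesis using resolutionD(2)[OF R] by (simp add: D0)
  next
    case (Suc j)
    have "hom_vec (?T (Suc j)) (?T (Suc (Suc j)) ! k) (D (Suc j) (unit k))"
      if k: "k < length (?T (Suc (Suc j)))" for k
    proof (cases "k < n (Suc (Suc j))")
      case True
      have "D (Suc j) (unit k) = d (Suc j) (unit k)"
        using DS[of "unit k" j 0] True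
        by (simp add: D'_def lin scale_simps free_closed module_mapD[OF Em])
      moreover have "hom_vec (L (Suc j)) (L (Suc (Suc j)) ! k) (d (Suc j) (unit k))"
        using resolutionD(2)[OF R, of "Suc j"] True by (simp add: graded_map_def n_def)
      ultimately show ?thesis
        using True by (simp add: cone_shifts_def nth_append n_def hom_vec_append)
    next
      case False
      define l where "l = k - n (Suc (Suc j))"
      have l: "l < length (M (Suc j))" using k False by (auto simp: l_def n_def)
      have un: "(unit k :: ('x, 'k) vec) = raise (n (Suc (Suc j))) (unit l)"
        using False by (intro poly_mapping_eqI) (auto simp: lookup_unit lookup_raise l_def)
      have "D (Suc j) (unit k) = scale z (\<phi> (Suc j) (unit l)) - E j (unit l)"
        using DS[of 0 j "unit l"] un by (simp add: D'_def lin free_closed)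
      moreover have "hom_vec (?T (Suc j)) (M (Suc j) ! l + (t + 1)) (scale z (\<phi> (Suc j) (unit l)))"
      proof -
        have "hom_vec (L (Suc j)) (M (Suc j) ! l + t) (\<phi> (Suc j) (unit l))"
          using \<phi>g[of "Suc j"] l by (simp add: graded_map_def)
        from hom_vec_append[OF hom_vec_scale[OF z this]] show ?thesis
          by (simp add: cone_shifts_def algebra_simps)
      qed
      moreover have "hom_vec (?T (Suc j)) (M (Suc j) ! l + (t + 1)) (E j (unit l))"
      proof (cases j)
        case 0
        then show ?thesis by (simp add: E_def hom_vec_closed)
      next
        case (Suc i)
        have "hom_vec (M (Suc i)) (M (Suc (Suc i)) ! l) (e (Suc i) (unit l))"
          using resolutionD(2)[OF S, of "Suc i"] l Suc by (simp add: graded_map_def)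
        from hom_vec_raise[OF hom_vec_shift[OF this, of "t + 1"]] show ?thesis
          using Suc by (simp add: E_def n_def)
      qed
      ultimately show ?thesis
        using False l by (simp add: nth_append n_def l_def hom_vec_closed)
    qed
    then show ?thesis using Suc by (simp add: graded_map_def Dm)
  qed

  have complex: "cycle ?C D i (D i v)" if v: "v \<in> free (length (?T (Suc i)))" for i v
  proof (cases i)
    case 0
    then show ?thesis by simp
  next
    case (Suc j)
    obtain u w where u: "u \<in> free (n (Suc (Suc j)))" and w: "w \<in> free (length (M (Suc j)))"
      and v: "v = u + raise (n (Suc (Suc j))) w"
      using split[of v j] v Suc by blast
    have Dv: "D i v = D' j u w" by (simp add: Suc v DS[OF u])
    show ?thesis
    proof (cases j)
      case 0
      define x y where "x = lookup (d 0 (\<phi> 1 w)) 0" and "y = lookup (e 0 w) 0"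
      have xy: "x - p * y \<in> A" using \<phi>c0[of w] w 0 by (simp add: x_def y_def)
      have "lookup (d 0 (D' 0 u w)) 0 = lookup (d 0 (d 1 u)) 0 + z * x"
        by (simp add: D'_def E_def lin lookup_add x_def)
      also have "\<dots> = (lookup (d 0 (d 1 u)) 0 + z * (x - p * y)) + y * (z * p)"
        by (simp add: algebra_simps)
      finally have eq: "lookup (d 0 (D' 0 u w)) 0
          = (lookup (d 0 (d 1 u)) 0 + z * (x - p * y)) + y * (z * p)" .
      have "lookup (d 0 (d 1 u)) 0 + z * (x - p * y) \<in> A"
        using u 0 by (intro graded_idealD(2,3)[OF A] dd0 xy) (simp add: n_def)
      then have "lookup (d 0 (D' 0 u w)) 0 \<in> ?C" using eq by blast
      moreover have "cycle ?C D i (D i v) \<longleftrightarrow> lookup (d 0 (D' 0 u w)) 0 \<in> ?C"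
        unfolding Dv unfolding Suc 0 by (simp add: D0 in_relations_0)
      ultimately show ?thesis by simp
    next
      case (Suc h)
      have u': "d (Suc j) u + scale z (\<phi> (Suc j) w) \<in> free (n (Suc (Suc h)))"
        using dF[of u "Suc j"] \<phi>F[OF w] u Suc by (auto simp: n_def intro!: free_closed)
      have "D' j u w = (d (Suc j) u + scale z (\<phi> (Suc j) w)) + raise (n (Suc (Suc h))) (- e j w)"
        using Suc by (simp add: D'_def E_def lin)
      then have "D (Suc h) (D' j u w) = D' h (d (Suc j) u + scale z (\<phi> (Suc j) w)) (- e j w)"
        using DS[OF u'] by simp
      also have "\<dots> = 0"
        using dd[of u h] \<phi>cS[of w h] ee[of w "h - 1"] u w Suc
        by (cases h) (simp_all add: D'_def E_def lin scale_simps n_def)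
      finally show ?thesis using \<open>i = Suc j\<close> Suc Dv by simp
    qed
  qed

  have exact: "\<exists>v'\<in>free (length (?T (Suc i))). D i v' - v \<in> relations ?C i"
    if v: "v \<in> free (length (?T i))" and cyc: "cycle ?C D i v" for i v
  proof -
    consider "i = 0" | "i = Suc 0" | j where "i = Suc (Suc j)" by (metis not0_implies_Suc)
    then show ?thesis
    proof cases
      case 1
      obtain u where u: "u \<in> free (length (L (Suc 0)))" "d 0 u - v \<in> relations A 0"
        using resolutionD(6)[OF R, of v 0] v 1 by auto
      have "a \<in> ?C" if "a \<in> A" for a
      proof -
        have "a = a + 0 * (z * p)" by simp
        then show ?thesis using that by blast
      qed
      from this[of "lookup (d 0 u - v) 0"] have "D 0 u - v \<in> relations ?C 0"
        using u(2) by (simp only: D0 in_relations_0)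
      then show ?thesis using u(1) 1 by (intro bexI[of _ u]) simp_all
    next
      case 2
      have "lookup (d 0 v) 0 \<in> ?C" using cyc 2 by (simp add: D0 in_relations_0)
      then obtain a r where a: "a \<in> A" "lookup (d 0 v) 0 = a + r * (z * p)" by blast
      \<comment> \<open>Correcting \<open>v\<close> by the image of a lift \<open>w\<close> of \<open>r\<close> removes the multiple of \<open>z * p\<close>.\<close>
      obtain w where w: "w \<in> free (length (M (Suc 0)))" "e 0 w - scale r (unit 0) \<in> relations B 0"
        using resolutionD(6)[OF S, of "scale r (unit 0)" 0] by (auto simp: M0 free_closed)
      define x y where "x = lookup (d 0 (\<phi> 1 w)) 0" and "y = lookup (e 0 w) 0"
      have xy: "x - p * y \<in> A" using \<phi>c0[OF w(1)] by (simp add: x_def y_def)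
      have "y - r \<in> B" using w(2) by (simp add: in_relations_0 lookup_minus lookup_unit y_def)
      then have yr: "p * (y - r) \<in> A" by (rule pB)
      let ?v = "v - scale z (\<phi> (Suc 0) w)"
      have "lookup (d 0 ?v) 0 = a + r * (z * p) - z * x"
        by (simp add: lin lookup_minus a(2) x_def)
      also have "\<dots> = (a - z * (x - p * y)) - z * (p * (y - r))" by (simp add: algebra_simps)
      also have "\<dots> \<in> A" 
        by (rule graded_idealD(6)[OF A graded_idealD(6)[OF A a(1) graded_idealD(3)[OF A xy]]
            graded_idealD(3)[OF A yr]])
      finally have "cycle A d (Suc 0) ?v" by (simp add: in_relations_0)
      moreover have "?v \<in> free (length (L (Suc 0)))"
        using v 2 \<phi>F[OF w(1)] by (intro free_closed) auto
      ultimately obtain u where u: "u \<in> free (n (Suc (Suc 0)))" "d (Suc 0) u = ?v"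
        using resolutionD(6)[OF R, of ?v "Suc 0"] by (auto simp: n_def)
      have "D (Suc 0) (u + raise (n (Suc (Suc 0))) w) = v"
        unfolding DS[OF u(1)] by (simp add: D'_def E_def u(2))
      then show ?thesis using join[OF u(1), of w] w(1) 2 by fastforce
    next
      case (3 j)
      obtain U W where U: "U \<in> free (n (Suc (Suc j)))" and W: "W \<in> free (length (M (Suc j)))"
        and vUW: "v = U + raise (n (Suc (Suc j))) W"
        using split[of v j] v 3 by blast
      have D'0: "D' j U W = 0" using cyc 3 vUW DS[OF U] by simp
      have lowF: "d (Suc j) U + scale z (\<phi> (Suc j) W) \<in> free (n (Suc j))"
        using dF[of U "Suc j"] \<phi>F[OF W] U by (auto simp: n_def intro!: free_closed)
      have low0: "d (Suc j) U + scale z (\<phi> (Suc j) W) = 0" and E0: "E j W = 0"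
      proof -
        have eq: "d (Suc j) U + scale z (\<phi> (Suc j) W) = E j W" using D'0 by (simp add: D'_def)
        have "low (n (Suc j)) (E j W) = 0" by (simp add: E_def low_raise split_simps)
        then show "d (Suc j) U + scale z (\<phi> (Suc j) W) = 0"
          using low_free[OF lowF] eq by simp
        then show "E j W = 0" using eq by simp
      qed
      \<comment> \<open>In the lowest stage this is where injectivity of multiplication by \<open>z * p\<close> enters.\<close>
      have "cycle B e (Suc j) W"
      proof (cases j)
        case 0
        define x y where "x = lookup (d 0 (\<phi> 1 W)) 0" and "y = lookup (e 0 W) 0"
        have xy: "x - p * y \<in> A" using \<phi>c0[of W] W 0 by (simp add: x_def y_def)
        have "d 0 (d 1 U) + scale z (d 0 (\<phi> 1 W)) = 0"
          using arg_cong[OF low0, of "d 0"] 0 by (simp add: lin)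
        then have "lookup (d 0 (d 1 U)) 0 + z * x = 0"
          by (metis lookup_add lookup_scale lookup_zero x_def)
        moreover have "lookup (d 0 (d 1 U)) 0 \<in> A" using dd0[of U] U 0 by (simp add: n_def)
        ultimately have "z * x \<in> A"
          using graded_idealD(5)[OF A] by (metis add_eq_0_iff)
        from graded_idealD(6)[OF A this graded_idealD(3)[OF A xy, of z]]
        have "z * x - z * (x - p * y) \<in> A" .
        then have "z * p * y \<in> A" by (simp add: algebra_simps)
        then show ?thesis using colon 0 by (simp add: in_relations_0 y_def)
      next
        case (Suc h)
        then have "high (n (Suc j)) (E j W) = e j W" by (simp add: E_def high_raise)
        then show ?thesis using E0 Suc by (simp add: split_simps)
      qed
      then obtain w where w: "w \<in> free (length (M (Suc (Suc j))))" "e (Suc j) w = W"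
        using resolutionD(6)[OF S W] by auto
      let ?u = "U + scale z (\<phi> (Suc (Suc j)) w)"
      have "?u \<in> free (length (L (Suc (Suc j))))"
        using U \<phi>F[OF w(1)] by (auto simp: n_def intro!: free_closed)
      moreover have "cycle A d (Suc (Suc j)) ?u"
        using \<phi>cS[OF w(1)] low0 w(2) by (simp add: lin)
      ultimately obtain u where u: "u \<in> free (n (Suc (Suc (Suc j))))" "d (Suc (Suc j)) u = ?u"
        using resolutionD(6)[OF R, of ?u "Suc (Suc j)"] by (auto simp: n_def)
      have "D (Suc (Suc j)) (u + raise (n (Suc (Suc (Suc j)))) (- w)) = v"
        unfolding DS[OF u(1)] by (simp add: D'_def E_def u(2) w(2) vUW lin scale_simps)
      moreover have "- w \<in> free (length (M (Suc (Suc j))))" using w(1) by (rule free_closed)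
      ultimately show ?thesis using join[OF u(1), of "- w"] 3 by fastforce
    qed
  qed

  have minimal: "lookup (lookup (D (Suc j) v) k) 0 = 0"
    if v: "v \<in> free (length (?T (Suc (Suc j))))" for j v k
  proof -
    obtain u w where u: "u \<in> free (n (Suc (Suc j)))" and w: "w \<in> free (length (M (Suc j)))"
      and v: "v = u + raise (n (Suc (Suc j))) w"
      using split[OF v] by blast
    have "lookup (lookup (d (Suc j) u) k) 0 = 0"
      using resolutionD(7)[OF R] u by (simp add: n_def)
    moreover have "lookup (lookup (E j w) k) 0 = 0"
    proof (cases j)
      case (Suc h)
      then show ?thesis using resolutionD(7)[OF S, of w h] w by (simp add: E_def lookup_raise)
    qed (simp add: E_def)
    ultimately show ?thesis
      unfolding v DS[OF u] by (simp add: D'_def lookup_add lookup_minus lookup_zero_mult z0)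
  qed

  have "resolution ?C ?T D"
    unfolding resolution_def using L0 graded complex exact minimal by auto
  then show ?thesis by blast
qed

section \<open>Adding a monomial to a monomial ideal\<close>

lemma keys_monomial_mult: "keys (monomial m * q) = (\<lambda>w. m + w) ` keys q"
proof -
  have "lookup (monomial m * q) (m + w) = lookup q w" for w
  proof -
    have "monomial m * q = (\<Sum>u\<in>keys q. Poly_Mapping.single (m + u) (lookup q u))"
      by (subst monomial_expansion[of q]) (simp add: sum_distrib_left mult_single)
    then have "lookup (monomial m * q) (m + w) = (\<Sum>u\<in>keys q. if u = w then lookup q u else 0)"
      by (simp add: lookup_sum lookup_single when_def)
    also have "\<dots> = lookup q w" by (auto simp: in_keys_iff)
    finally show ?thesis .
  qed
  then show ?thesis
    using Poly_Mapping.keys_mult[of "monomial m" q] by (fastforce simp: in_keys_iff)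
qed

lemma monomial_dvd:
  assumes "keys f \<subseteq> {m + w | w. True}"
  shows "\<exists>r. f = r * monomial m"
proof
  let ?r = "\<Sum>u\<in>keys f. Poly_Mapping.single (u - m) (lookup f u)"
  have "?r * monomial m = (\<Sum>u\<in>keys f. Poly_Mapping.single (u - m + m) (lookup f u))"
    by (simp add: sum_distrib_right mult_single)
  also have "\<dots> = (\<Sum>u\<in>keys f. Poly_Mapping.single u (lookup f u))"
  proof (rule sum.cong)
    fix u assume "u \<in> keys f"
    then obtain w where "u = m + w" using assms by blast
    then show "Poly_Mapping.single (u - m + m) (lookup f u) = Poly_Mapping.single u (lookup f u)"
      by (simp add: add.commute)
  qed simp
  also have "\<dots> = f" by (rule monomial_expansion[symmetric])
  finally show "f = ?r * monomial m" by simp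
qed

lemma monomial_ideal_add_monomial:
  assumes U: "upset U"
  shows "monomial_ideal (U \<union> {m + w | w. True}) = {a + r * monomial m | a r. a \<in> monomial_ideal U}"
proof (intro Set.set_eqI iffI)
  fix f assume f: "f \<in> monomial_ideal (U \<union> {m + w | w. True})"
  define a where "a = Poly_Mapping.mapp (\<lambda>u c. if u \<in> U then c else 0) f"
  have a: "lookup a u = (if u \<in> U then lookup f u else 0)" for u
    unfolding a_def by (rule lookup_mapp_zero) simp
  have "keys (f - a) \<subseteq> {m + w | w. True}"
    using f by (auto simp: monomial_ideal_def in_keys_iff lookup_minus a split: if_splits)
  then obtain r where "f - a = r * monomial m" using monomial_dvd by blast
  then have "f = a + r * monomial m" by (simp add: algebra_simps)
  moreover have "a \<in> monomial_ideal U"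
    by (auto simp: monomial_ideal_def in_keys_iff a split: if_splits)
  ultimately show "f \<in> {a + r * monomial m | a r. a \<in> monomial_ideal U}" by blast
next
  fix f assume "f \<in> {a + r * monomial m | a r. a \<in> monomial_ideal U}"
  then obtain a r where f: "f = a + r * monomial m" "keys a \<subseteq> U" by (auto simp: monomial_ideal_def)
  have "keys (r * monomial m) \<subseteq> {m + w | w. True}"
    using keys_monomial_mult[of m r] by (auto simp: mult.commute)
  then show "f \<in> monomial_ideal (U \<union> {m + w | w. True})"
    using Poly_Mapping.keys_add[of a "r * monomial m"] f by (auto simp: monomial_ideal_def)
qed

text \<open>For monomial ideals the colon ideal is again monomial, and \<open>W\<close> is its set of exponents.\<close>

lemma monomial_cone:
  fixes U W :: "('x \<Rightarrow>\<^sub>0 nat) set"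
  assumes U: "upset U" and W: "W = {w. Poly_Mapping.single i 1 + m + w \<in> U}"
    and sub: "\<And>w. w \<in> W \<Longrightarrow> m + w \<in> U"
    and R: "resolution (monomial_ideal U :: ('x, 'k::field) mpoly set) L d"
    and S: "resolution (monomial_ideal W :: ('x, 'k) mpoly set) M e"
  shows "\<exists>D. resolution (monomial_ideal (U \<union> {Poly_Mapping.single i 1 + m + w | w. True}) :: ('x, 'k) mpoly set)
      (cone_shifts (int (monom_degree m) + 1) L M) D"
proof -
  have W': "upset W" using U by (auto simp: upset_def W add.assoc[symmetric])
  have z: "homogeneous 1 (monomial (Poly_Mapping.single i 1) :: ('x, 'k) mpoly)"
    by (simp add: homogeneous_def)
  have zp: "monomial (Poly_Mapping.single i 1) * monomial m
      = (monomial (Poly_Mapping.single i 1 + m) :: ('x, 'k) mpoly)"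
    by (simp add: mult_single)
  have pB: "monomial m * q \<in> monomial_ideal U" if "q \<in> monomial_ideal W" for q :: "('x, 'k) mpoly"
    using that sub by (auto simp: monomial_ideal_def keys_monomial_mult)
  have colon: "q \<in> monomial_ideal W"
    if "monomial (Poly_Mapping.single i 1) * monomial m * q \<in> monomial_ideal U" for q :: "('x, 'k) mpoly"
    using that unfolding zp by (auto simp: monomial_ideal_def keys_monomial_mult W)
  show ?thesis
    using mapping_cone[OF graded_ideal_monomial_ideal[OF U] graded_ideal_monomial_ideal[OF W']
        R S homogeneous_monomial z pB colon]
    unfolding zp monomial_ideal_add_monomial[OF U] .
qed

lemma resolution_zero_ideal:
  "resolution (monomial_ideal {} :: ('x, 'k::field) mpoly set)
     (\<lambda>i. if i \<le> 1 then [0] else []) (\<lambda>i. if i = 0 then (\<lambda>v. v) else (\<lambda>v. 0))"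
  unfolding resolution_def
proof (intro conjI allI ballI impI)
  show "graded_map 0 (if Suc i \<le> 1 then [0] else []) (if i \<le> 1 then [0] else [])
      (if i = 0 then (\<lambda>v. v) else (\<lambda>v. 0 :: ('x, 'k) vec))" for i
    using hom_vec_unit[of 0 "[0]"]
    by (auto simp: graded_map_def module_map_id module_map_zero hom_vec_closed)
next
  fix i and v :: "('x, 'k) vec"
  assume v: "v \<in> free (length (if i \<le> 1 then [0::int] else []))"
    and c: "cycle (monomial_ideal {}) (\<lambda>i. if i = 0 then (\<lambda>v. v) else (\<lambda>v. 0)) i v"
  have zero: "v = 0" if "i \<noteq> 0"
  proof (rule poly_mapping_eqI)
    fix k
    show "lookup v k = lookup 0 k"
      using v c that by (cases i; cases k) (auto simp: free_iff in_relations_0 monomial_ideal_def split: if_splits)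
  qed
  show "\<exists>u\<in>free (length (if Suc i \<le> 1 then [0::int] else [])).
      (if i = 0 then (\<lambda>v. v) else (\<lambda>v. 0)) u - v \<in> relations (monomial_ideal {}) i"
  proof (cases i)
    case 0
    then show ?thesis using v by (intro bexI[of _ v]) (auto simp: in_relations_0 monomial_ideal_def)
  next
    case (Suc j)
    then show ?thesis using zero free_closed(1)[of 0] by auto
  qed
qed (auto simp: cycle_def relations_def monomial_ideal_def split: nat.split)


section \<open>Forests and induced matchings\<close>

lemma has_cycle_mono: "has_cycle F \<Longrightarrow> F \<subseteq> E \<Longrightarrow> has_cycle E"
  unfolding has_cycle_def by blast

text \<open>The first vertex of a longest path is a leaf: a further neighbour outside the path would prolong
  the path, and one on the path would close a cycle.\<close>

lemma forest_has_leaf: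
  fixes E :: "'x::finite set set"
  assumes E: "E \<noteq> {}" and card: "\<And>e. e \<in> E \<Longrightarrow> card e = 2" and acyclic: "\<not> has_cycle E"
  obtains x y where "{x, y} \<in> E" "x \<noteq> y" "x \<notin> \<Union>(E - {{x, y}})"
proof -
  define path where "path vs \<longleftrightarrow> distinct vs \<and> 2 \<le> length vs \<and>
      (\<forall>i. Suc i < length vs \<longrightarrow> {vs ! i, vs ! Suc i} \<in> E)" for vs
  obtain a b where ab: "{a, b} \<in> E" "a \<noteq> b"
    using E card by (metis all_not_in_conv card_2_iff)
  have "path [a, b]" using ab by (auto simp: path_def)
  moreover have "length vs \<le> card (UNIV :: 'x set)" if "path vs" for vs
    using that distinct_card[of vs] card_mono[of UNIV "set vs"] by (auto simp: path_def)
  ultimately obtain vs where vs: "path vs" and max: "\<And>ws. path ws \<Longrightarrow> length ws \<le> length vs"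
    using ex_has_greatest_nat[of path "[a, b]" length "Suc (card (UNIV :: 'x set))"]
    by (metis less_Suc_eq_le)
  obtain x y zs where xyz: "vs = x # y # zs"
    using vs by (auto simp: path_def numeral_2_eq_2 Suc_le_length_iff)
  have xy: "{x, y} \<in> E" using vs unfolding path_def xyz by (auto dest: spec[of _ 0])
  have "x \<notin> \<Union>(E - {{x, y}})"
  proof
    assume "x \<in> \<Union>(E - {{x, y}})"
    then obtain e where e: "e \<in> E" "e \<noteq> {x, y}" "x \<in> e" by blast
    then obtain w where w: "e = {x, w}" "w \<noteq> x"
      using card[OF e(1)] by (auto simp: card_2_iff)
    show False
    proof (cases "w \<in> set vs")
      case False
      have "path (w # vs)"
        unfolding path_def
      proof (intro conjI allI impI)
        fix i assume "Suc i < length (w # vs)"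
        then show "{(w # vs) ! i, (w # vs) ! Suc i} \<in> E"
          using vs e w by (cases i) (auto simp: path_def xyz insert_commute)
      qed (use vs False in \<open>auto simp: path_def\<close>)
      then show False using max[of "w # vs"] by simp
    next
      case True
      then obtain k where k: "k < length vs" "vs ! k = w" by (auto simp: in_set_conv_nth)
      have k2: "2 \<le> k"
      proof (rule ccontr)
        assume "\<not> 2 \<le> k"
        then have "k = 0 \<or> k = 1" by auto
        then show False using k w e by (auto simp: xyz)
      qed
      have "has_cycle E"
        unfolding has_cycle_def
      proof (intro exI[of _ "take (Suc k) vs"] conjI allI impI)
        fix i assume "i < length (take (Suc k) vs)"
        then have "i < k \<or> i = k" using k by auto
        then show "{take (Suc k) vs ! i, take (Suc k) vs ! (Suc i mod length (take (Suc k) vs))} \<in> E"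
        proof
          assume "i < k"
          then show ?thesis using vs k by (auto simp: path_def min_def)
        next
          assume "i = k"
          have "take (Suc k) vs ! k = w" "length (take (Suc k) vs) = Suc k"
            using k by simp_all
          moreover have "take (Suc k) vs ! 0 = x" by (simp add: xyz)
          ultimately
          show ?thesis using \<open>i = k\<close> e w by (simp add: insert_commute)
        qed
      qed (use vs k k2 in \<open>auto simp: path_def\<close>)
      then show False using acyclic by contradiction
    qed
  qed
  moreover have "x \<noteq> y" using vs by (simp add: path_def xyz)
  ultimately show thesis using that xy by blast
qed

definition induced_matching :: "'x set set \<Rightarrow> 'x set set \<Rightarrow> bool" where
  "induced_matching E S \<longleftrightarrow> S \<subseteq> E \<and> pairwise (disconnected_edges E) S"

definition matching_number :: "'x set set \<Rightarrow> nat" where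
  "matching_number E = Max {card S | S. induced_matching E S}"

lemma finite_matching_cards: "finite {card S | S. induced_matching (E :: 'x::finite set set) S}"
  by (simp add: setcompr_eq_image)

lemma card_le_matching_number:
  fixes E :: "'x::finite set set"
  shows "induced_matching E S \<Longrightarrow> card S \<le> matching_number E"
  unfolding matching_number_def by (rule Max_ge[OF finite_matching_cards]) blast

lemma matching_number_attained:
  fixes E :: "'x::finite set set"
  obtains S where "induced_matching E S" "card S = matching_number E"
proof -
  have "induced_matching E {}" by (simp add: induced_matching_def pairwise_def)
  then have "matching_number E \<in> {card S | S. induced_matching E S}"
    unfolding matching_number_def by (intro Max_in[OF finite_matching_cards]) blast
  then show thesis using that by auto
qed

lemma matching_number_empty [simp]: "matching_number ({} :: 'x::finite set set) = 0"
proof -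
  obtain S where "induced_matching ({} :: 'x set set) S" "card S = matching_number ({} :: 'x set set)"
    by (rule matching_number_attained)
  then show ?thesis by (simp add: induced_matching_def)
qed

lemma disconnected_edges_sym: "disconnected_edges E e f \<Longrightarrow> disconnected_edges E f e"
  unfolding disconnected_edges_def
proof (intro conjI ballI)
  fix u v assume "e \<inter> f = {} \<and> (\<forall>u\<in>e. \<forall>v\<in>f. {u, v} \<notin> E)" "u \<in> f" "v \<in> e"
  then have "{v, u} \<notin> E" by simp
  then show "{u, v} \<notin> E" by (simp add: insert_commute)
qed auto

lemma induced_matching_subset: "induced_matching E S \<Longrightarrow> T \<subseteq> S \<Longrightarrow> induced_matching E T"
  unfolding induced_matching_def using pairwise_subset by blast

lemma induced_matching_subgraph:
  "induced_matching E S \<Longrightarrow> S \<subseteq> F \<Longrightarrow> F \<subseteq> E \<Longrightarrow> induced_matching F S"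
  unfolding induced_matching_def pairwise_def disconnected_edges_def by (meson subsetD)

text \<open>If a set of pairwise disconnected edges contains the edge at the leaf \<open>x\<close>, then its other edges
  avoid \<open>y\<close> and all neighbours of \<open>y\<close>, so they lie in \<open>H\<close>; otherwise they all lie in \<open>F\<close>.
  Conversely, \<open>x\<close> has no neighbour but \<open>y\<close>, so the edge \<open>xy\<close> is disconnected from every edge of
  \<open>H\<close>, and putting it back connects no edges of \<open>F\<close>.\<close>

lemma matching_number_leaf:
  fixes E :: "'x::finite set set"
  assumes xy: "{x, y} \<in> E" "x \<noteq> y" and leaf: "x \<notin> \<Union>(E - {{x, y}})"
    and F: "F = E - {{x, y}}"
    and H: "H = {e \<in> F. e \<inter> insert y {v. {y, v} \<in> F} = {}}"
  shows "matching_number E = max (matching_number F) (Suc (matching_number H))"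
proof (rule antisym)
  obtain S where S: "induced_matching E S" "card S = matching_number E"
    by (rule matching_number_attained)
  show "matching_number E \<le> max (matching_number F) (Suc (matching_number H))"
  proof (cases "{x, y} \<in> S")
    case True
    have "S - {{x, y}} \<subseteq> H"
    proof
      fix e assume e: "e \<in> S - {{x, y}}"
      then have "disconnected_edges E {x, y} e"
        using S(1) True by (auto simp: induced_matching_def pairwise_def)
      then have 1: "{x, y} \<inter> e = {}" and 2: "\<And>v. v \<in> e \<Longrightarrow> {y, v} \<notin> E"
        by (auto simp: disconnected_edges_def)
      have "e \<in> F" using e S(1) by (auto simp: F induced_matching_def)
      moreover have "v \<notin> insert y {v. {y, v} \<in> F}" if "v \<in> e" for v
        using 1 2[OF that] that by (auto simp: F)
      ultimately show "e \<in> H" unfolding H by blast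
    qed
    moreover have "induced_matching E (S - {{x, y}})"
      by (rule induced_matching_subset[OF S(1)]) simp
    moreover have "H \<subseteq> E" by (auto simp: H F)
    ultimately have "induced_matching H (S - {{x, y}})"
      using induced_matching_subgraph by metis
    from card_le_matching_number[OF this] have "card (S - {{x, y}}) \<le> matching_number H" .
    moreover have "card S = Suc (card (S - {{x, y}}))"
      using card_Suc_Diff1[OF _ True] by simp
    ultimately show ?thesis using S(2) by simp
  next
    case False
    then have "induced_matching F S"
      using S(1) by (intro induced_matching_subgraph[OF S(1)]) (simp_all add: F induced_matching_def subset_Diff_insert)
    from card_le_matching_number[OF this] show ?thesis using S(2) by simp
  qed
  have "matching_number F \<le> matching_number E"
  proof -
    obtain S where S: "induced_matching F S" "card S = matching_number F"
      by (rule matching_number_attained)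
    have "induced_matching E S"
      unfolding induced_matching_def pairwise_def
    proof (intro conjI ballI impI)
      show "S \<subseteq> E" using S(1) by (auto simp: induced_matching_def F)
      fix e f assume ef: "e \<in> S" "f \<in> S" "e \<noteq> f"
      then have d: "disconnected_edges F e f" and "e \<in> F" "f \<in> F"
        using S(1) by (auto simp: induced_matching_def pairwise_def)
      then have "x \<notin> e" "x \<notin> f" using leaf by (auto simp: F)
      then have "{u, v} \<noteq> {x, y}" if "u \<in> e" "v \<in> f" for u v
        using that by (auto simp: doubleton_eq_iff)
      then show "disconnected_edges E e f" using d by (auto simp: disconnected_edges_def F)
    qed
    from card_le_matching_number[OF this] show ?thesis using S(2) by simp
  qed
  moreover have "Suc (matching_number H) \<le> matching_number E"
  proof -
    obtain S where S: "induced_matching H S" "card S = matching_number H"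
      by (rule matching_number_attained)
    have SH: "S \<subseteq> H" using S(1) by (simp add: induced_matching_def)
    have y: "y \<notin> e" "x \<notin> e" "e \<in> F" if "e \<in> H" for e using that leaf by (auto simp: H F)
    have nbr: "v \<notin> e" if "e \<in> H" "{y, v} \<in> E" for e v
    proof (cases "v = x")
      case True
      then show ?thesis using y[OF that(1)] by simp
    next
      case False
      then have "{y, v} \<noteq> {x, y}" using xy(2) by (simp add: doubleton_eq_iff)
      then have "{y, v} \<in> F" using that(2) by (simp add: F)
      then show ?thesis using that(1) by (auto simp: H)
    qed
    have xnbr: "v = y" if "{x, v} \<in> E" for v
    proof (rule ccontr)
      assume "v \<noteq> y"
      then have "{x, v} \<in> E - {{x, y}}" using that by (simp add: doubleton_eq_iff)
      then show False using leaf by blast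
    qed
    have new: "disconnected_edges E {x, y} e" if "e \<in> H" for e
      unfolding disconnected_edges_def using y[OF that] nbr[OF that] xnbr by blast
    have new': "disconnected_edges E e {x, y}" if "e \<in> H" for e
      by (rule disconnected_edges_sym[OF new[OF that]])
    have old: "disconnected_edges E e f" if ef: "e \<in> S" "f \<in> S" "e \<noteq> f" for e f
    proof -
      have d: "disconnected_edges H e f" and eH: "e \<in> H" and fH: "f \<in> H"
        using S(1) ef by (auto simp: induced_matching_def pairwise_def)
      have "{u, v} \<in> H" if uv: "u \<in> e" "v \<in> f" "{u, v} \<in> E" for u v
      proof -
        have "u \<notin> insert y {v. {y, v} \<in> F}" using uv(1) eH unfolding H by blast
        moreover have "v \<notin> insert y {v. {y, v} \<in> F}" using uv(2) fH unfolding H by blast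
        moreover have "{u, v} \<noteq> {x, y}"
          using uv y(2)[OF eH] y(2)[OF fH] by (auto simp: doubleton_eq_iff)
        then have "{u, v} \<in> F" using uv(3) by (simp add: F)
        ultimately show ?thesis unfolding H by blast
      qed
      then show ?thesis using d unfolding disconnected_edges_def by blast
    qed
    have "induced_matching E (insert {x, y} S)"
      unfolding induced_matching_def pairwise_def
    proof (intro conjI ballI impI)
      show "insert {x, y} S \<subseteq> E" using xy SH by (auto simp: H F)
      fix e f assume "e \<in> insert {x, y} S" "f \<in> insert {x, y} S" "e \<noteq> f"
      then consider "e = {x, y}" "f \<in> S" | "f = {x, y}" "e \<in> S" | "e \<in> S" "f \<in> S" "e \<noteq> f"
        by blast
      then show "disconnected_edges E e f"
        using new new' old SH by cases auto
    qed
    from card_le_matching_number[OF this] have "card (insert {x, y} S) \<le> matching_number E" .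
    moreover have "{x, y} \<notin> S" using SH y by blast
    ultimately show ?thesis using S(2) by simp
  qed
  ultimately show "max (matching_number F) (Suc (matching_number H)) \<le> matching_number E" by simp
qed

section \<open>Edge ideals of forests\<close>

text \<open>The exponents of the monomials in the ideal generated by the edges and by the variables in \<open>V\<close>.
  The variables are there because passing to a colon ideal turns edges into variables.\<close>

definition edge_upset :: "'x set set \<Rightarrow> 'x set \<Rightarrow> ('x \<Rightarrow>\<^sub>0 nat) set" where
  "edge_upset E V = {u. (\<exists>e\<in>E. e \<subseteq> keys u) \<or> V \<inter> keys u \<noteq> {}}"

lemma keys_add_nat: "keys (u + w) = keys u \<union> keys (w :: 'x \<Rightarrow>\<^sub>0 nat)"
  by (auto simp: in_keys_iff lookup_add)

lemma upset_edge_upset: "upset (edge_upset E V)"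
  by (auto simp: upset_def edge_upset_def keys_add_nat)

lemma multiples_eq:
  fixes i :: 'x
  shows "{Poly_Mapping.single i (1::nat) + w | w. True} = {u. i \<in> keys u}"
proof (intro Set.set_eqI iffI)
  fix u :: "'x \<Rightarrow>\<^sub>0 nat" assume "u \<in> {u. i \<in> keys u}"
  then have "0 < lookup u i" by (simp add: in_keys_iff)
  then show "u \<in> {Poly_Mapping.single i (1::nat) + w | w. True}"
    by (rule monomial_remove_var) blast
qed (auto simp: keys_add_nat)

lemma multiples_edge_eq:
  fixes x y :: 'x
  assumes "x \<noteq> y"
  shows "{Poly_Mapping.single x (1::nat) + Poly_Mapping.single y 1 + w | w. True} = {u. {x, y} \<subseteq> keys u}"
proof (intro Set.set_eqI iffI)
  fix u :: "'x \<Rightarrow>\<^sub>0 nat" assume u: "u \<in> {u. {x, y} \<subseteq> keys u}"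
  then have "0 < lookup u x" by (simp add: in_keys_iff)
  then obtain w where w: "u = Poly_Mapping.single x 1 + w" by (rule monomial_remove_var)
  have "0 < lookup w y" using u w assms by (auto simp: in_keys_iff lookup_add lookup_single when_def)
  then obtain w' where "w = Poly_Mapping.single y 1 + w'" by (rule monomial_remove_var)
  then show "u \<in> {Poly_Mapping.single x (1::nat) + Poly_Mapping.single y 1 + w | w. True}"
    using w by (auto simp: add.assoc)
qed (auto simp: keys_add_nat)

lemma edge_ideal_eq:
  fixes E :: "'x set set"
  assumes card: "\<And>e. e \<in> E \<Longrightarrow> card e = 2"
  shows "(edge_ideal E :: ('x, 'k::field) mpoly set) = monomial_ideal (edge_upset E {})"
proof -
  define S where "S = {Poly_Mapping.single i (1::nat) + Poly_Mapping.single j 1 | i j. {i, j} \<in> E}"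
  have "{Var i * Var j | i j. {i, j} \<in> E} = (monomial ` S :: ('x, 'k) mpoly set)"
    by (auto simp: S_def Var_def mult_single)
  moreover have "{m + w | m w. m \<in> S} = edge_upset E {}"
  proof (intro Set.set_eqI iffI)
    fix u assume "u \<in> {m + w | m w. m \<in> S}"
    then obtain i j w where ij: "{i, j} \<in> E" "u = Poly_Mapping.single i 1 + Poly_Mapping.single j 1 + w"
      by (auto simp: S_def)
    then have "{i, j} \<subseteq> keys u" by (simp add: keys_add_nat)
    then show "u \<in> edge_upset E {}" using ij(1) unfolding edge_upset_def by blast
  next
    fix u assume "u \<in> edge_upset E {}"
    then obtain e where e: "e \<in> E" "e \<subseteq> keys u" by (auto simp: edge_upset_def)
    then obtain i j where ij: "e = {i, j}" "i \<noteq> j" using card by (metis card_2_iff)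
    then have "u \<in> {Poly_Mapping.single i 1 + Poly_Mapping.single j 1 + w | w. True}"
      using e(2) multiples_edge_eq[of i j] by auto
    then show "u \<in> {m + w | m w. m \<in> S}" using e(1) ij by (auto simp: S_def)
  qed
  ultimately show ?thesis unfolding edge_ideal_def by (simp add: genideal_monomials)
qed

text \<open>The number \<open>r\<close> is the largest difference between a shift and its homological degree. The lower
  bound for the shifts leaves only finitely many differences, so that this largest one is their
  \<open>Max\<close>.\<close>

definition bounded_resolution :: "nat \<Rightarrow> ('x, 'k::field) mpoly set \<Rightarrow> bool" where
  "bounded_resolution r I \<longleftrightarrow> (\<exists>L d. resolution I L d \<and>
     (\<forall>i. \<forall>j\<in>set (L (Suc i)). int i \<le> j \<and> j \<le> int i + int r) \<and>
     (\<exists>i. int i + int r \<in> set (L (Suc i))))"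

lemma bounded_resolution_cone:
  fixes U W :: "('x \<Rightarrow>\<^sub>0 nat) set"
  assumes U: "upset U" and W: "W = {w. Poly_Mapping.single i 1 + m + w \<in> U}"
    and sub: "\<And>w. w \<in> W \<Longrightarrow> m + w \<in> U"
    and R: "bounded_resolution r (monomial_ideal U :: ('x, 'k::field) mpoly set)"
    and S: "bounded_resolution s (monomial_ideal W :: ('x, 'k) mpoly set)"
  shows "bounded_resolution (max r (s + monom_degree m))
    (monomial_ideal (U \<union> {Poly_Mapping.single i 1 + m + w | w. True}) :: ('x, 'k) mpoly set)"
proof -
  let ?C = "monomial_ideal (U \<union> {Poly_Mapping.single i 1 + m + w | w. True}) :: ('x, 'k) mpoly set"
  let ?c = "int (monom_degree m) + 1"
  obtain L d where L: "resolution (monomial_ideal U :: ('x, 'k) mpoly set) L d"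
      "\<forall>i. \<forall>j\<in>set (L (Suc i)). int i \<le> j \<and> j \<le> int i + int r"
      "\<exists>i. int i + int r \<in> set (L (Suc i))"
    using R unfolding bounded_resolution_def by (elim exE conjE) (rule that, assumption+, rule exI)
  obtain M e where M: "resolution (monomial_ideal W :: ('x, 'k) mpoly set) M e"
      "\<forall>i. \<forall>j\<in>set (M (Suc i)). int i \<le> j \<and> j \<le> int i + int s"
      "\<exists>i. int i + int s \<in> set (M (Suc i))"
    using S unfolding bounded_resolution_def by (elim exE conjE) (rule that, assumption+, rule exI)
  obtain D where D: "resolution ?C (cone_shifts ?c L M) D"
    using monomial_cone[OF U W sub L(1) M(1)] by blast
  have bound: "int i \<le> j \<and> j \<le> int i + int (max r (s + monom_degree m))"
    if j: "j \<in> set (cone_shifts ?c L M (Suc i))" for i j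
  proof (cases "j \<in> set (L (Suc i))")
    case True
    then have "int i \<le> j \<and> j \<le> int i + int r" using L(2) by simp
    then show ?thesis unfolding of_nat_max by linarith
  next
    case False
    then obtain h b where "i = Suc h" "b \<in> set (M (Suc h))" "j = b + ?c"
      using j by (auto simp: cone_shifts_def split: nat.splits)
    moreover from this have "int h \<le> b \<and> b \<le> int h + int s" using M(2) by simp
    ultimately show ?thesis unfolding of_nat_max of_nat_add of_nat_Suc by linarith
  qed
  have "\<exists>i. int i + int (max r (s + monom_degree m)) \<in> set (cone_shifts ?c L M (Suc i))"
  proof (cases "s + monom_degree m \<le> r")
    case True
    obtain i where "int i + int r \<in> set (L (Suc i))" using L(3) by blast
    then show ?thesis using True by (intro exI[of _ i]) (simp add: cone_shifts_def max_def)
  next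
    case False
    obtain i where "int i + int s \<in> set (M (Suc i))" using M(3) by blast
    then have "(int i + int s) + ?c \<in> set (cone_shifts ?c L M (Suc (Suc i)))" by simp
    moreover have "(int i + int s) + ?c = int (Suc i) + int (max r (s + monom_degree m))"
      using False by simp
    ultimately show ?thesis by metis
  qed
  moreover have "\<forall>i. \<forall>j\<in>set (cone_shifts ?c L M (Suc i)).
      int i \<le> j \<and> j \<le> int i + int (max r (s + monom_degree m))"
    by (intro allI ballI bound)
  ultimately show ?thesis
    unfolding bounded_resolution_def using D
    by (intro exI[of _ "cone_shifts ?c L M"] exI[of _ D] conjI)
qed

text \<open>A variable that does not occur in a monomial ideal is a nonzerodivisor modulo it, so the colon
  ideal is the ideal itself. The cone over multiplication by that variable, with \<open>m = 0\<close>, is a step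
  of the Koszul complex.\<close>

lemma bounded_resolution_variables:
  fixes V :: "'x::finite set"
  shows "bounded_resolution 0 (monomial_ideal (edge_upset {} V) :: ('x, 'k::field) mpoly set)"
proof (induction V rule: finite_induct[OF finite])
  case 1
  have "edge_upset {} {} = ({} :: ('x \<Rightarrow>\<^sub>0 nat) set)" by (simp add: edge_upset_def)
  then show ?case unfolding bounded_resolution_def
    using resolution_zero_ideal[where 'x = 'x and 'k = 'k]
    by (intro exI[of _ "\<lambda>i. if i \<le> 1 then [0] else []"] exI[of _ "\<lambda>i. if i = 0 then (\<lambda>v. v) else (\<lambda>v. 0)"])
       (auto intro: exI[of _ 0])
next
  case (2 z V)
  have "edge_upset {} V = {w. Poly_Mapping.single z 1 + 0 + w \<in> edge_upset {} V}"
    using 2(2) by (auto simp: edge_upset_def keys_add_nat)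
  from bounded_resolution_cone[OF upset_edge_upset this _ 2(3) 2(3)]
  have "bounded_resolution 0 (monomial_ideal (edge_upset {} V \<union>
      {Poly_Mapping.single z 1 + 0 + w | w. True}) :: ('x, 'k) mpoly set)" by simp
  moreover have "edge_upset {} V \<union> {Poly_Mapping.single z 1 + 0 + w | w. True} = edge_upset {} (insert z V)"
    using multiples_eq[of z] by (auto simp: edge_upset_def)
  ultimately show ?case by simp
qed

text \<open>The cone is taken over multiplication by a leaf and its neighbour. The colon ideal belongs to the
  smaller forest \<open>H\<close> and the enlarged set of variables \<open>V \<union> N\<close>, which is why \<open>V\<close> is arbitrary in
  the induction.\<close>

theorem bounded_resolution_forest:
  fixes E :: "'x::finite set set"
  assumes "\<And>e. e \<in> E \<Longrightarrow> card e = 2" and "\<not> has_cycle E" and "V \<inter> \<Union>E = {}"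
  shows "bounded_resolution (matching_number E)
    (monomial_ideal (edge_upset E V) :: ('x, 'k::field) mpoly set)"
  using assms
proof (induction "card E" arbitrary: E V rule: less_induct)
  case less
  show ?case
  proof (cases "E = {}")
    case True
    then show ?thesis by (simp add: bounded_resolution_variables)
  next
    case False
    obtain x y where xy: "{x, y} \<in> E" "x \<noteq> y" and leaf: "x \<notin> \<Union>(E - {{x, y}})"
      using forest_has_leaf[OF False less.prems(1,2)] by blast
    define F where "F = E - {{x, y}}"
    define N where "N = {v. {y, v} \<in> F}"
    define H where "H = {e \<in> F. e \<inter> insert y N = {}}"
    have F: "F \<subset> E" "x \<notin> \<Union>F" using xy leaf by (auto simp: F_def)
    have H: "H \<subset> E" using F by (auto simp: H_def)
    have xyV: "x \<notin> V" "y \<notin> V" using xy less.prems(3) by auto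
    have F2: "\<exists>v. e = {y, v} \<and> v \<noteq> y" if "e \<in> F" "y \<in> e" for e
    proof -
      have "card e = 2" using that F less.prems(1) by blast
      then show ?thesis using that(2) by (auto simp: card_2_iff)
    qed
    have BF: "bounded_resolution (matching_number F)
        (monomial_ideal (edge_upset F V) :: ('x, 'k) mpoly set)"
    proof (rule less.hyps)
      show "card F < card E" using F(1) by (intro psubset_card_mono) simp_all
      show "card e = 2" if "e \<in> F" for e using that F(1) less.prems(1) by blast
      show "\<not> has_cycle F" using F(1) less.prems(2) has_cycle_mono[of F E] by blast
      show "V \<inter> \<Union>F = {}" using F(1) less.prems(3) by blast
    qed
    have BH: "bounded_resolution (matching_number H)
        (monomial_ideal (edge_upset H (V \<union> N)) :: ('x, 'k) mpoly set)"
    proof (rule less.hyps)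
      show "card H < card E" using H by (intro psubset_card_mono) simp_all
      show "card e = 2" if "e \<in> H" for e using that H less.prems(1) by blast
      show "\<not> has_cycle H" using H less.prems(2) has_cycle_mono[of H E] by blast
      have "V \<inter> \<Union>H = {}" using H less.prems(3) by blast
      moreover have "N \<inter> \<Union>H = {}" by (auto simp: H_def)
      ultimately show "(V \<union> N) \<inter> \<Union>H = {}" by blast
    qed
    have colon: "edge_upset H (V \<union> N)
        = {w. Poly_Mapping.single x 1 + Poly_Mapping.single y 1 + w \<in> edge_upset F V}"
    proof (intro Set.set_eqI iffI)
      fix w assume w: "w \<in> edge_upset H (V \<union> N)"
      then show "w \<in> {w. Poly_Mapping.single x 1 + Poly_Mapping.single y 1 + w \<in> edge_upset F V}"
        by (fastforce simp: edge_upset_def keys_add_nat H_def N_def)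
    next
      fix w assume "w \<in> {w. Poly_Mapping.single x 1 + Poly_Mapping.single y 1 + w \<in> edge_upset F V}"
      then consider e where "e \<in> F" "e \<subseteq> {x, y} \<union> keys w" | "V \<inter> ({x, y} \<union> keys w) \<noteq> {}"
        by (auto simp: edge_upset_def keys_add_nat)
      then show "w \<in> edge_upset H (V \<union> N)"
      proof cases
        \<comment> \<open>An edge at \<open>y\<close> loses \<open>y\<close> and leaves a variable of \<open>N\<close>, which absorbs the other edges at it.\<close>
        case (1 e)
        have xe: "x \<notin> e" using F 1(1) by blast
        show ?thesis
        proof (cases "y \<in> e")
          case True
          then obtain v where v: "e = {y, v}" "v \<noteq> y" using F2 1(1) by blast
          then have "v \<in> N \<inter> keys w" using 1 xe by (auto simp: N_def)
          then show ?thesis by (auto simp: edge_upset_def)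
        next
          case False
          then have "e \<subseteq> keys w" using 1(2) xe by auto
          then show ?thesis using 1(1) False by (auto simp: edge_upset_def H_def)
        qed
      next
        case 2
        then show ?thesis using xyV by (auto simp: edge_upset_def)
      qed
    qed
    have sub: "Poly_Mapping.single y 1 + w \<in> edge_upset F V" if "w \<in> edge_upset H (V \<union> N)" for w
      using that by (fastforce simp: edge_upset_def keys_add_nat H_def N_def)
    have "edge_upset F V \<union> {Poly_Mapping.single x 1 + Poly_Mapping.single y 1 + w | w. True} = edge_upset E V"
      unfolding multiples_edge_eq[OF xy(2)] using xy(1) by (auto simp: edge_upset_def F_def)
    then show ?thesis
      using bounded_resolution_cone[OF upset_edge_upset colon sub BF BH]
        matching_number_leaf[OF xy leaf F_def H_def[unfolded N_def]] by simp
  qed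
qed

theorem theorem2p18:
  fixes E :: "'x::finite set set"
  assumes "one_dim_forest E"
  shows "cm_regularity (quotient_module (edge_ideal E :: ('x, 'k::field) mpoly set)) =
    int (Max {card S | S. S \<subseteq> E \<and> pairwise (disconnected_edges E) S})"
proof -
  let ?I = "monomial_ideal (edge_upset E {}) :: ('x, 'k) mpoly set"
  let ?\<nu> = "matching_number E"
  have E: "\<And>e. e \<in> E \<Longrightarrow> card e = 2" "\<not> has_cycle E"
    using assms by (auto simp: one_dim_forest_def)
  obtain L d where L: "resolution ?I L d"
      "\<And>i j. j \<in> set (L (Suc i)) \<Longrightarrow> int i \<le> j \<and> j \<le> int i + int ?\<nu>"
      "\<exists>i. int i + int ?\<nu> \<in> set (L (Suc i))"
    using bounded_resolution_forest[OF E, of "{}"] unfolding bounded_resolution_def by auto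
  let ?J = "{j. \<exists>i. graded_betti (quotient_module ?I) i (int i + j) \<noteq> 0}"
  have J: "?J = {j. \<exists>i. int i + j \<in> set (L (Suc i))}"
    using graded_betti_nonzero_iff[OF graded_ideal_monomial_ideal[OF upset_edge_upset] L(1)] by simp
  have bound: "0 \<le> j \<and> j \<le> int ?\<nu>" if j: "j \<in> ?J" for j
  proof -
    obtain i where "int i + j \<in> set (L (Suc i))" using j unfolding J by blast
    from L(2)[OF this] show ?thesis by simp
  qed
  have "?J \<subseteq> {0..int ?\<nu>}" using bound by (intro subsetI) (simp only: atLeastAtMost_iff)
  then have "finite ?J" by (rule finite_subset) simp
  moreover have "int ?\<nu> \<in> ?J" using L(3) unfolding J by simp
  ultimately have "Max ?J = int ?\<nu>" using bound by (intro Max_eqI) blast+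
  then show ?thesis
    by (simp add: cm_regularity_def edge_ideal_eq[OF E(1)] matching_number_def induced_matching_def)
qed

end
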